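(* Let $G$ be an $r$-regular graph on $n$ vertices which is neither bipartite nor an $n$-cycle. Consider the anti-voter Markov chain on $G$ in its equilibrium, with states $J^{(t)}=(J^{(t)}_1,\dots,J^{(t)}_n)\in\{0,1\}^n$, and put $J_i=J_i^{(0)}$, $W=\sum_{i=1}^nJ_i^{(0)}$, $W'=\sum_{i=1}^nJ_i^{(1)}$, $\mu=\mathbb{E}W$, $\sigma^2=\operatorname{Var}W$, $q_{\max}=\max_{k\in\mathbb{Z}}\mathbb{P}[W=k]$ and $S=\mathbb{P}[W'=W+1\mid W]$. Then, with $\lambda=2/n$, $$d_{\mathrm{TV}}(\mathscr{L}(W),\mathrm{TP}(\mu,\sigma^2))\le\frac{\sqrt{\operatorname{Var}S}}{\lambda\sigma^2}+\frac{2}{\sigma^2},\qquad d_{\mathrm{loc}}(\mathscr{L}(W),\mathrm{TP}(\mu,\sigma^2))\le\frac{2\sqrt{q_{\max}\operatorname{Var}S}}{\lambda\sigma^2}+\frac{2}{\sigma^2},$$ and $$\operatorname{Var}S\le\frac{16r^2\sigma^2+\operatorname{Var}Q}{16r^2n^2},\qquad\text{where } Q=\sum_{i=1}^n\sum_{j\in\mathcal{N}_i}(2J_i-1)(2J_j-1).$$ Hence, along any sequence of such graphs with $n\to\infty$ (with $r=r(n)$) and $\sigma^2\to\infty$, $$d_{\mathrm{TV}}(\mathscr{L}(W),\mathrm{TP}(\mu,\sigma^2))=O\Bigl(\frac{\sqrt{\operatorname{Var}Q}}{r\sigma^2}+\frac1\sigma\Bigr),\qquad d_{\mathrm{loc}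}(\mathscr{L}(W),\mathrm{TP}(\mu,\sigma^2))=O\Bigl(\frac{(\operatorname{Var}Q)^{3/4}}{r^{3/2}\sigma^3}+\frac1{\sigma^{3/2}}\Bigr).$$
   Context: Anti-voter model: each vertex $i$ of $G$ carries an opinion $J_i^{(t)}\in\{0,1\}$ at each time $t\in\{0,1,2,\dots\}$. Transition rule from time $t$ to $t+1$: choose a vertex $i$ uniformly at random; then choose a vertex $j$ uniformly at random from the set $\mathcal{N}_i$ of neighbours of $i$ in $G$; set $J_i^{(t+1)}=1-J_j^{(t)}$ and leave all other opinions unchanged. "In its equilibrium" means that $J^{(0)}$ is distributed according to the (unique) stationary distribution of this chain. $\mathscr{L}(X)$ denotes the law of $X$. Translated Poisson distribution: for $\mu\in\mathbb{R}$, $\sigma^2>0$, an integer-valued random variable $Y$ has law $\mathrm{TP}(\mu,\sigma^2)$ if $\mathscr{L}(Y-\mu+\sigma^2+\gamma)=\mathrm{Po}(\sigma^2+\gamma)$, where $\gamma=\langle\mu-\sigma^2\rangle$, $\langle x\rangle=x-\lfloor x\rfloor$ is the fractional part, and $\mathrm{Po}(\nu)$ is the Poisson distribution with mean $\nu$. For probability distributions $P,Q$ on $\mathbb{Z}$ with point probabilities $p_k,q_k$: $d_{\mathrm{TV}}(P,Q)=\sup_{A\subset\mathbb{Z}}|P(A)-Q(A)|$ and $d_{\mathrm{loc}}(P,Q)=\sup_{k\in\mathbb{Z}}|p_k-q_k|$. *)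

theory Defs
  imports
    "HOL-Probability.Probability"
    "HOL-Library.Landau_Symbols"
    "Graph_Theory.Pair_Digraph"
begin

section \<open>Graphs\<close>

text \<open>Finite simple graphs are the graphs of the locale \<^locale>\<open>pair_graph\<close> (finite, symmetric,
  loopfree, without parallel arcs); connectedness is not part of that locale.\<close>

definition neighbours :: "'a pair_pre_digraph \<Rightarrow> 'a \<Rightarrow> 'a set" where
  "neighbours G i = {j. (i, j) \<in> parcs G}"

definition regular_graph :: "'a pair_pre_digraph \<Rightarrow> nat \<Rightarrow> bool" where
  "regular_graph G r \<longleftrightarrow> (\<forall>i \<in> pverts G. card (neighbours G i) = r)"

definition bipartite_graph :: "'a pair_pre_digraph \<Rightarrow> bool" where
  "bipartite_graph G \<longleftrightarrow>
     (\<exists>A B. A \<union> B = pverts G \<and> A \<inter> B = {} \<and> parcs G \<subseteq> A \<times> B \<union> B \<times> A)"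

definition cycle_graph :: "'a pair_pre_digraph \<Rightarrow> nat \<Rightarrow> bool" where
  "cycle_graph G n \<longleftrightarrow> 3 \<le> n \<and>
     (\<exists>v. bij_betw v {..<n} (pverts G) \<and>
        parcs G = (\<Union>k<n. {(v k, v (Suc k mod n)), (v (Suc k mod n), v k)}))"

section \<open>The anti-voter chain\<close>

text \<open>A state assigns to each vertex an opinion in \<open>{0, 1}\<close>; states are extensional functions,
  so that two states are equal as soon as they agree on the vertices.\<close>

definition opinion_states :: "'a pair_pre_digraph \<Rightarrow> ('a \<Rightarrow> int) set" where
  "opinion_states G = pverts G \<rightarrow>\<^sub>E {0, 1}"

definition anti_voter_step :: "'a pair_pre_digraph \<Rightarrow> ('a \<Rightarrow> int) \<Rightarrow> ('a \<Rightarrow> int) pmf" where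
  "anti_voter_step G J =
     bind_pmf (pmf_of_set (pverts G)) (\<lambda>i.
     bind_pmf (pmf_of_set (neighbours G i)) (\<lambda>j.
     return_pmf (J(i := 1 - J j))))"

definition anti_voter_equilibrium :: "'a pair_pre_digraph \<Rightarrow> ('a \<Rightarrow> int) pmf \<Rightarrow> bool" where
  "anti_voter_equilibrium G \<pi> \<longleftrightarrow>
     set_pmf \<pi> \<subseteq> opinion_states G \<and> bind_pmf \<pi> (anti_voter_step G) = \<pi>"

text \<open>The joint law of \<open>(J\<^sup>(\<^sup>0\<^sup>), J\<^sup>(\<^sup>1\<^sup>))\<close> when \<open>J\<^sup>(\<^sup>0\<^sup>)\<close> has law \<open>\<pi>\<close>.\<close>

definition anti_voter_pair ::
    "'a pair_pre_digraph \<Rightarrow> ('a \<Rightarrow> int) pmf \<Rightarrow> (('a \<Rightarrow> int) \<times> ('a \<Rightarrow> int)) pmf" where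
  "anti_voter_pair G \<pi> = bind_pmf \<pi> (\<lambda>J. map_pmf (\<lambda>J'. (J, J')) (anti_voter_step G J))"

definition av_W :: "'a pair_pre_digraph \<Rightarrow> ('a \<Rightarrow> int) \<Rightarrow> int" where
  "av_W G J = (\<Sum>i\<in>pverts G. J i)"

definition av_Q :: "'a pair_pre_digraph \<Rightarrow> ('a \<Rightarrow> int) \<Rightarrow> int" where
  "av_Q G J = (\<Sum>i\<in>pverts G. \<Sum>j\<in>neighbours G i. (2 * J i - 1) * (2 * J j - 1))"

text \<open>The random variable \<open>S = P[W' = W + 1 | W]\<close>, as a function of the state \<open>J = J\<^sup>(\<^sup>0\<^sup>)\<close>; the
  conditioning is elementary because \<open>W\<close> is discrete.\<close>

definition av_S :: "'a pair_pre_digraph \<Rightarrow> ('a \<Rightarrow> int) pmf \<Rightarrow> ('a \<Rightarrow> int) \<Rightarrow> real" where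
  "av_S G \<pi> J =
     \<P>((J0, J1) in anti_voter_pair G \<pi>. av_W G J1 = av_W G J0 + 1 \<bar> av_W G J0 = av_W G J)"

definition law_W :: "'a pair_pre_digraph \<Rightarrow> ('a \<Rightarrow> int) pmf \<Rightarrow> int pmf" where
  "law_W G \<pi> = map_pmf (av_W G) \<pi>"

definition mean_W :: "'a pair_pre_digraph \<Rightarrow> ('a \<Rightarrow> int) pmf \<Rightarrow> real" where
  "mean_W G \<pi> = measure_pmf.expectation \<pi> (\<lambda>J. real_of_int (av_W G J))"

definition var_W :: "'a pair_pre_digraph \<Rightarrow> ('a \<Rightarrow> int) pmf \<Rightarrow> real" where
  "var_W G \<pi> = measure_pmf.variance \<pi> (\<lambda>J. real_of_int (av_W G J))"

definition var_Q :: "'a pair_pre_digraph \<Rightarrow> ('a \<Rightarrow> int) pmf \<Rightarrow> real" where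
  "var_Q G \<pi> = measure_pmf.variance \<pi> (\<lambda>J. real_of_int (av_Q G J))"

definition var_S :: "'a pair_pre_digraph \<Rightarrow> ('a \<Rightarrow> int) pmf \<Rightarrow> real" where
  "var_S G \<pi> = measure_pmf.variance \<pi> (av_S G \<pi>)"

text \<open>The supremum is a maximum, since \<open>W\<close> takes finitely many values.\<close>

definition q_max :: "'a pair_pre_digraph \<Rightarrow> ('a \<Rightarrow> int) pmf \<Rightarrow> real" where
  "q_max G \<pi> = (SUP k. measure_pmf.prob \<pi> {J. av_W G J = k})"

section \<open>Distances and the translated Poisson distribution\<close>

definition d_TV :: "int pmf \<Rightarrow> int pmf \<Rightarrow> real" where
  "d_TV P P' = (SUP A. \<bar>measure_pmf.prob P A - measure_pmf.prob P' A\<bar>)"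

definition d_loc :: "int pmf \<Rightarrow> int pmf \<Rightarrow> real" where
  "d_loc P P' = (SUP k. \<bar>pmf P k - pmf P' k\<bar>)"

text \<open>\<open>TP \<mu> s\<close>, where \<open>s\<close> is the variance parameter \<open>\<sigma>\<^sup>2\<close>, is the law of an integer-valued \<open>Y\<close> for
  which \<open>Y - \<mu> + s + \<gamma>\<close> has law \<open>Po (s + \<gamma>)\<close>, where \<open>\<gamma> = frac (\<mu> - s)\<close>. Since
  \<open>\<mu> - s - \<gamma> = \<lfloor>\<mu> - s\<rfloor>\<close>, this is a Poisson law shifted by an integer; \<open>TP_iff\<close> confirms that the
  defining property determines it.\<close>

definition TP :: "real \<Rightarrow> real \<Rightarrow> int pmf" where
  "TP \<mu> s = map_pmf (\<lambda>m. int m + \<lfloor>\<mu> - s\<rfloor>) (poisson_pmf (s + frac (\<mu> - s)))"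

lemma TP_iff:
  fixes \<mu> s :: real and P :: "int pmf"
  defines "\<gamma> \<equiv> frac (\<mu> - s)"
  shows "map_pmf (\<lambda>y. real_of_int y - \<mu> + s + \<gamma>) P = map_pmf real (poisson_pmf (s + \<gamma>))
         \<longleftrightarrow> P = TP \<mu> s"
proof -
  let ?f = "\<lambda>y. real_of_int y - \<mu> + s + \<gamma>"
  have "(\<lambda>m. ?f (int m + \<lfloor>\<mu> - s\<rfloor>)) = real"
    by (auto simp: \<gamma>_def frac_def)
  then have "map_pmf ?f (TP \<mu> s) = map_pmf real (poisson_pmf (s + \<gamma>))"
    unfolding TP_def map_pmf_comp \<gamma>_def by (rule arg_cong)
  moreover have "map_pmf ?f P = map_pmf ?f (TP \<mu> s) \<longleftrightarrow> P = TP \<mu> s"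
    by (rule inj_eq[OF pmf.inj_map]) (auto simp: inj_on_def)
  ultimately show ?thesis
    by simp
qed

end

theory Submission
  imports Defs
begin

text \<open>The proof is Stein's method with a birth-death structure. In one step \<open>W\<close> moves by at most one, so in
equilibrium the flow of mass from \<open>k\<close> to \<open>k + 1\<close> equals the flow back; this holds for the image \<open>W\<close> even
though the chain \<open>J\<close> itself is not reversible. On an \<open>r\<close>-regular graph the drift of \<open>W\<close> is linear,
\<open>-\<lambda> (W - n / 2)\<close>. Together these say that \<open>\<tau> = S / \<lambda>\<close> is a discrete Stein kernel of \<open>W\<close>: for every \<open>g\<close>,
\<open>E ((W - \<mu>) g(W)) = E (\<tau>(W) (g(W + 1) - g(W)))\<close> (\<open>up_kernel\<close>, \<open>stein_kernel_W\<close>). The Poisson law of mean \<open>\<nu>\<close>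
satisfies such an identity with a constant kernel, and the variance of \<open>S\<close> measures how far \<open>\<tau>\<close> is from
its mean \<open>\<sigma>\<^sup>2\<close>.

The comparison is made in the locale \<open>stein_kernel\<close>. A test set is replaced by the solution \<open>g\<close> of the
Stein equation of \<open>Po(\<nu>)\<close>, with \<open>\<nu> = \<sigma>\<^sup>2 + \<gamma>\<close>, transported by the integer shift. What has to be bounded is
the mean of \<open>(\<sigma>\<^sup>2 - \<tau>) \<Delta>g\<close>, and Cauchy-Schwarz does that: \<open>\<bar>\<Delta>g\<bar> \<le> 1 / \<nu>\<close> gives the total variation bound, and for
a singleton test set the increments even satisfy \<open>\<Sum> (\<Delta>g)\<^sup>2 \<le> 2 / \<nu>\<^sup>2\<close>, which gives the local bound after
each point probability of \<open>W\<close> has been replaced by \<open>q\<^sub>m\<^sub>a\<^sub>x\<close>. The two corrections of size \<open>1 / \<sigma>\<^sup>2\<close> come from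
the rounding \<open>\<gamma> < 1\<close> and from the mass of \<open>W\<close> below the support of the translated Poisson law.

For the variance of \<open>S\<close>, conditioning on \<open>W\<close> only decreases the variance of the one-step probability
\<open>P(W' = W + 1 | J)\<close>, which is the affine combination \<open>3 / 4 - W / n + Q / (4 n r)\<close>. The claimed bound follows once
\<open>W\<close> and \<open>Q\<close> are uncorrelated. For a connected graph this is the symmetry \<open>J \<mapsto> 1 - J\<close> of the unique
equilibrium. A non-bipartite \<open>G\<close> may however have bipartite components, on which equilibria are not
unique, so a direct argument is used. On a bipartite component the chain is a voter model in
disguise and has reached consensus: neighbours disagree almost surely, and the component contributes
a constant to \<open>W\<close> (\<open>frozen_antiparallel\<close>, \<open>sum_spin_unfrozen\<close>). On the other components the first and
third moments of the spins \<open>2 J\<^sub>i - 1\<close> satisfy a harmonic equation with a sign change along every arc,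
and the maximum principle forces them to vanish (\<open>moment1_zero\<close>, \<open>moment3_zero\<close>).

For the rates, \<open>q\<^sub>m\<^sub>a\<^sub>x\<close> is bounded by the total variation distance plus the largest point probability of a
Poisson law, which is of order \<open>1 / \<sigma>\<close> (\<open>poisson_pmf_le\<close>).\<close>

section \<open>Distances between laws on the integers\<close>

lemma abs_prob_diff_le_d_TV: "\<bar>measure_pmf.prob P B - measure_pmf.prob P' B\<bar> \<le> d_TV P P'"
  unfolding d_TV_def
proof (rule cSUP_upper)
  show "bdd_above (range (\<lambda>A. \<bar>measure_pmf.prob P A - measure_pmf.prob P' A\<bar>))"
  proof (rule bdd_aboveI2)
    fix A
    have "measure_pmf.prob P A \<in> {0..1}" "measure_pmf.prob P' A \<in> {0..1}" by simp_all
    then show "\<bar>measure_pmf.prob P A - measure_pmf.prob P' A\<bar> \<le> 1"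
      unfolding atLeastAtMost_iff by linarith
  qed
qed simp

lemma d_TV_nonneg: "0 \<le> d_TV P P'"
  using abs_prob_diff_le_d_TV[of P "{}" P'] by simp

lemma d_loc_nonneg: "0 \<le> d_loc P P'"
proof -
  have "\<bar>pmf P 0 - pmf P' 0\<bar> \<le> d_loc P P'"
    unfolding d_loc_def
  proof (rule cSUP_upper)
    show "bdd_above (range (\<lambda>k. \<bar>pmf P k - pmf P' k\<bar>))"
    proof (rule bdd_aboveI2)
      fix k show "\<bar>pmf P k - pmf P' k\<bar> \<le> 1"
        using pmf_le_1[of P k] pmf_le_1[of P' k] pmf_nonneg[of P k] pmf_nonneg[of P' k] by linarith
    qed
  qed simp
  then show ?thesis by linarith
qed

lemma pmf_le_d_TV: "pmf P k \<le> d_TV P P' + pmf P' k"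
  using abs_prob_diff_le_d_TV[of P "{k}" P'] by (simp add: measure_pmf_single)

text \<open>The finite support makes every real function integrable, so that the inequality reduces to the one
for finite sums with weights \<open>sqrt (pmf P x)\<close>.\<close>

lemma expectation_Cauchy_Schwarz:
  fixes f g :: "'b \<Rightarrow> real"
  assumes "finite (set_pmf P)"
  shows "measure_pmf.expectation P (\<lambda>x. f x * g x)
    \<le> sqrt (measure_pmf.expectation P (\<lambda>x. (f x)\<^sup>2)) * sqrt (measure_pmf.expectation P (\<lambda>x. (g x)\<^sup>2))"
proof -
  let ?w = "\<lambda>x. sqrt (pmf P x)"
  have E: "measure_pmf.expectation P h = (\<Sum>x\<in>set_pmf P. h x * pmf P x)" for h :: "'b \<Rightarrow> real"
    using assms by (intro integral_measure_pmf_real) auto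
  have "(\<Sum>x\<in>set_pmf P. (f x * ?w x) * (g x * ?w x))\<^sup>2
     \<le> (\<Sum>x\<in>set_pmf P. (f x * ?w x)\<^sup>2) * (\<Sum>x\<in>set_pmf P. (g x * ?w x)\<^sup>2)"
    by (rule Cauchy_Schwarz_ineq_sum)
  also have "(\<lambda>x. (f x * ?w x) * (g x * ?w x)) = (\<lambda>x. (f x * g x) * pmf P x)"
    by (rule ext) (simp add: algebra_simps flip: power2_eq_square)
  finally have "(measure_pmf.expectation P (\<lambda>x. f x * g x))\<^sup>2
    \<le> measure_pmf.expectation P (\<lambda>x. (f x)\<^sup>2) * measure_pmf.expectation P (\<lambda>x. (g x)\<^sup>2)"
    by (simp add: E power_mult_distrib)
  then show ?thesis
    by (simp add: real_le_rsqrt flip: real_sqrt_mult)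
qed

section \<open>The Stein equation of the Poisson law\<close>

text \<open>The bounded solution \<open>g\<close> of \<open>\<nu> g(k + 1) - k g(k) = 1\<^sub>A(k) - Po(A)\<close> in closed form. The value at \<open>0\<close> does not
enter the equation; division by zero makes it \<open>0\<close>, which lets \<open>g\<close> be continued by \<open>0\<close> to the negative
integers.\<close>

definition stein_sol :: "real \<Rightarrow> nat set \<Rightarrow> nat \<Rightarrow> real" where
  "stein_sol \<nu> A k =
     (measure_pmf.prob (poisson_pmf \<nu>) (A \<inter> {..<k})
       - measure_pmf.prob (poisson_pmf \<nu>) A * measure_pmf.prob (poisson_pmf \<nu>) {..<k})
     / (real k * pmf (poisson_pmf \<nu>) k)"

lemma stein_sol_0 [simp]: "stein_sol \<nu> A 0 = 0"
  by (simp add: stein_sol_def)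

lemma stein_sol_empty [simp]: "stein_sol \<nu> {} k = 0"
  by (simp add: stein_sol_def)

lemma prob_lessThan_Suc:
  "measure_pmf.prob p (A \<inter> {..<Suc k}) = measure_pmf.prob p (A \<inter> {..<k}) + pmf p k * indicator A k"
proof -
  have "A \<inter> {..<Suc k} = (A \<inter> {..<k}) \<union> (A \<inter> {k})" by (auto simp: less_Suc_eq)
  moreover have "measure_pmf.prob p (A \<inter> {k}) = pmf p k * indicator A k"
    by (cases "k \<in> A") (simp_all add: measure_pmf_single)
  ultimately show ?thesis
    by (simp add: measure_pmf.finite_measure_Union disjoint_iff)
qed

lemma prob_split_at:
  fixes k :: nat
  shows
  "measure_pmf.prob p A
     = measure_pmf.prob p (A \<inter> {..<k}) + pmf p k * indicator A k + measure_pmf.prob p (A \<inter> {k<..})"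
proof -
  have "A = (A \<inter> {..<Suc k}) \<union> (A \<inter> {k<..})" by (auto simp: not_less_eq)
  then have "measure_pmf.prob p A
      = measure_pmf.prob p (A \<inter> {..<Suc k}) + measure_pmf.prob p (A \<inter> {k<..})"
    by (metis (no_types, lifting) measure_pmf.finite_measure_Union UNIV_I sets_measure_pmf
        disjoint_iff IntE greaterThan_iff lessThan_iff not_less_eq)
  then show ?thesis by (simp add: prob_lessThan_Suc)
qed

context
  fixes \<nu> :: real
  assumes nu: "0 < \<nu>"
begin

abbreviation (input) "po \<equiv> pmf (poisson_pmf \<nu>)"
abbreviation (input) "Po \<equiv> measure_pmf.prob (poisson_pmf \<nu>)"

lemma poisson_pos: "po k > 0"
  using nu by simp

lemma poisson_Suc: "real (Suc k) * po (Suc k) = \<nu> * po k"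
  using nu by (simp add: field_simps del: of_nat_Suc)

lemma stein_sol_Suc:
  "stein_sol \<nu> A (Suc k) = (Po (A \<inter> {..<Suc k}) - Po A * Po {..<Suc k}) / (\<nu> * po k)"
  unfolding stein_sol_def poisson_Suc ..

lemma stein_equation:
  "\<nu> * stein_sol \<nu> A (Suc k) - real k * stein_sol \<nu> A k = indicator A k - Po A"
proof -
  have "Po {..<Suc k} = Po {..<k} + po k"
    using prob_lessThan_Suc[of "poisson_pmf \<nu>" UNIV k] by simp
  moreover have "real k * stein_sol \<nu> A k = (Po (A \<inter> {..<k}) - Po A * Po {..<k}) / po k"
    by (cases "k = 0") (simp_all add: stein_sol_def)
  moreover have "po k \<noteq> 0" using poisson_pos[of k] by linarith
  ultimately show ?thesis using nu
    by (simp only: stein_sol_Suc prob_lessThan_Suc) (simp add: field_simps del: pmf_poisson)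
qed

text \<open>The relation \<open>(j + 1) p\<^sub>j\<^sub>+\<^sub>1 = \<nu> p\<^sub>j\<close>, summed over \<open>j\<close>, turns \<open>\<nu>\<close> times a tail into a weighted sum over the
shifted tail, whose weights are on the right side of \<open>k\<close>. The two tail estimates are what makes the
increments of the Stein solution have a definite sign off the test set.\<close>

lemma poisson_lower_tail: "\<nu> * Po {..<k} \<le> real k * (Po {..<k} + po k)"
proof -
  have "Po {..<k} = sum po {..<k}" by (simp add: measure_measure_pmf_finite)
  then have "\<nu> * Po {..<k} = (\<Sum>j<k. real (Suc j) * po (Suc j))"
    by (simp only: sum_distrib_left poisson_Suc)
  also have "\<dots> \<le> (\<Sum>j<k. real k * po (Suc j))"
    by (intro sum_mono mult_right_mono) auto
  also have "\<dots> \<le> real k * (\<Sum>j<Suc k. po j)"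
    unfolding sum_distrib_left[symmetric] sum.lessThan_Suc_shift[of po]
    by (intro mult_left_mono) auto
  also have "(\<Sum>j<Suc k. po j) = Po {..<k} + po k"
    by (simp add: measure_measure_pmf_finite)
  finally show ?thesis .
qed

lemma poisson_upper_tail: "real k * Po {k<..} \<le> \<nu> * (po k + Po {k<..})"
proof -
  have *: "real k * Po {k<..<k + N} \<le> \<nu> * (po k + Po {k<..})" for N
  proof -
    have "real k * Po {k<..<k + N} = (\<Sum>j\<in>{k<..<k+N}. real k * po j)"
      by (simp add: measure_measure_pmf_finite sum_distrib_left)
    also have "\<dots> \<le> (\<Sum>j\<in>{k<..<k+N}. real j * po j)"
      by (intro sum_mono mult_right_mono) auto
    also have "\<dots> \<le> (\<Sum>j\<in>Suc ` {k..<k+N}. real j * po j)"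
      by (intro sum_mono2) (auto simp: image_Suc_atLeastLessThan)
    also have "\<dots> = \<nu> * (\<Sum>j\<in>{k..<k+N}. po j)"
      by (subst sum.reindex) (simp_all only: inj_Suc inj_on_subset[OF inj_Suc subset_UNIV] comp_def poisson_Suc sum_distrib_left)
    also have "(\<Sum>j\<in>{k..<k+N}. po j) = Po {k..<k+N}"
      by (simp add: measure_measure_pmf_finite)
    also have "\<dots> \<le> Po {k..}"
      by (intro measure_pmf.finite_measure_mono) auto
    also have "Po {k..} = po k + Po {k<..}"
    proof -
      have "{k..} = {k} \<union> {k<..}" by auto
      then have "Po {k..} = Po {k} + Po {k<..}"
        by (simp only: ) (subst measure_pmf.finite_measure_Union, auto)
      then show ?thesis by (simp add: measure_pmf_single)
    qed
    finally show ?thesis using nu by simp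
  qed
  have "(\<lambda>N. Po {k<..<k+N}) \<longlonglongrightarrow> Po (\<Union>N. {k<..<k+N})"
    by (intro measure_pmf.finite_Lim_measure_incseq) (auto simp: incseq_def)
  also have "(\<Union>N. {k<..<k+N}) = {k<..}"
    by auto presburger
  finally have "(\<lambda>N. real k * Po {k<..<k+N}) \<longlonglongrightarrow> real k * Po {k<..}"
    by (intro tendsto_intros)
  then show ?thesis
    by (rule LIMSEQ_le_const2) (use * in auto)
qed

text \<open>Split \<open>A\<close> into its parts below, at and above \<open>k\<close>. The increment is linear in the masses of the three
parts. The outer two enter with nonpositive coefficients by the tail estimates, and the mass at \<open>k\<close>
enters with a coefficient whose value is at most \<open>1 / (\<nu> p\<^sub>k)\<close>. In particular the increment can be positive
only at points of \<open>A\<close>.\<close>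

lemma stein_sol_diff_le:
  "stein_sol \<nu> A (Suc k) - stein_sol \<nu> A k \<le> indicator A k / \<nu>"
proof -
  define a b c L R p where "a = Po (A \<inter> {..<k})" and "b = Po (A \<inter> {k<..})"
    and "c = (indicator A k :: real)" and "L = Po {..<k}" and "R = Po {k<..}" and "p = po k"
  note d = a_def b_def c_def L_def R_def p_def
  have p: "p > 0" unfolding p_def by (rule poisson_pos)
  have nn: "0 \<le> a" "0 \<le> b" "0 \<le> L" "0 \<le> R" "0 \<le> c" by (auto simp: d)
  have total: "L + p + R = 1"
    using prob_split_at[of "poisson_pmf \<nu>" UNIV k] by (simp add: d del: pmf_poisson)
  have A: "Po A = a + p * c + b"
    unfolding d by (rule prob_split_at)
  have lo: "\<nu> * L \<le> real k * (L + p)" unfolding d by (rule poisson_lower_tail)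
  have up: "real k * R \<le> \<nu> * (p + R)" unfolding d by (rule poisson_upper_tail)
  have LS: "Po {..<Suc k} = L + p"
    using prob_lessThan_Suc[of "poisson_pmf \<nu>" UNIV k] by (simp add: d)
  have "stein_sol \<nu> A (Suc k) = ((a + p * c) - (a + p * c + b) * (L + p)) / (\<nu> * p)"
    unfolding stein_sol_Suc LS A prob_lessThan_Suc by (simp add: d)
  also have "(a + p * c) - (a + p * c + b) * (L + p) = (a + p * c) * R - b * (L + p)"
    using total by algebra
  finally have g1: "stein_sol \<nu> A (Suc k) = ((a + p * c) * R - b * (L + p)) / (\<nu> * p)" .
  have "stein_sol \<nu> A k = (a - (a + p * c + b) * L) / (real k * p)"
    unfolding stein_sol_def A by (simp add: d)
  also have "a - (a + p * c + b) * L = a * (p + R) - (p * c + b) * L"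
    using total by algebra
  finally have g0: "stein_sol \<nu> A k = (a * (p + R) - (p * c + b) * L) / (real k * p)" .
  show ?thesis
  proof (cases "k = 0")
    case True
    then have "a = 0" "L = 0" by (simp_all add: d)
    then have "stein_sol \<nu> A (Suc k) - stein_sol \<nu> A k = (p * c * R - b * p) / (\<nu> * p)"
      using g1 True by simp
    also have "\<dots> \<le> (p * c * 1) / (\<nu> * p)"
    proof (intro divide_right_mono)
      have "p * c * R \<le> p * c * 1"
        using total p nn \<open>L = 0\<close> by (intro mult_left_mono) auto
      then show "p * c * R - b * p \<le> p * c * 1"
        using p nn by (smt (verit) mult_nonneg_nonneg)
    qed (use p nu in auto)
    also have "\<dots> = c / \<nu>" using p by simp
    finally show ?thesis by (simp add: c_def)
  next
    case False
    then have k: "real k > 0" by simp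
    have "stein_sol \<nu> A (Suc k) - stein_sol \<nu> A k
        = (a * (real k * R - \<nu> * (p + R)) + p * c * (real k * R + \<nu> * L)
            + b * (\<nu> * L - real k * (L + p))) / (\<nu> * real k * p)"
      unfolding g0 g1 using k p nu by (simp add: field_simps)
    also have "\<dots> \<le> (p * c * real k) / (\<nu> * real k * p)"
    proof (intro divide_right_mono)
      have "a * (real k * R - \<nu> * (p + R)) \<le> 0"
        using nn up by (intro mult_nonneg_nonpos) auto
      moreover have "b * (\<nu> * L - real k * (L + p)) \<le> 0"
        using nn lo by (intro mult_nonneg_nonpos) auto
      moreover have "real k * R + \<nu> * L \<le> real k * (L + p + R)"
        using lo by (simp add: algebra_simps)
      then have "p * c * (real k * R + \<nu> * L) \<le> p * c * real k"
        unfolding total using p nn by (intro mult_left_mono) auto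
      ultimately show "a * (real k * R - \<nu> * (p + R)) + p * c * (real k * R + \<nu> * L)
            + b * (\<nu> * L - real k * (L + p)) \<le> p * c * real k" by linarith
    qed (use p nu k in auto)
    also have "\<dots> = c / \<nu>" using p k by simp
    finally show ?thesis by (simp add: c_def)
  qed
qed

lemma stein_sol_Compl: "stein_sol \<nu> (- A) k = - stein_sol \<nu> A k"
proof -
  have "- A \<inter> {..<k} = {..<k} - A \<inter> {..<k}" by auto
  then have "Po (- A \<inter> {..<k}) = Po {..<k} - Po (A \<inter> {..<k})"
    by (simp add: measure_pmf.finite_measure_Diff)
  moreover have "Po (- A) = 1 - Po A"
    using measure_pmf.prob_compl[of A "poisson_pmf \<nu>"] by (simp add: Compl_eq_Diff_UNIV)
  ultimately have "Po (- A \<inter> {..<k}) - Po (- A) * Po {..<k} = - (Po (A \<inter> {..<k}) - Po A * Po {..<k})"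
    by (simp only:) (simp add: algebra_simps)
  then show ?thesis
    unfolding stein_sol_def by (simp only: minus_divide_left)
qed

text \<open>The lower bound is the upper bound for the complement, since complementing \<open>A\<close> changes the sign of the
solution.\<close>

lemma stein_sol_diff_abs_le:
  "\<bar>stein_sol \<nu> A (Suc k) - stein_sol \<nu> A k\<bar> \<le> 1 / \<nu>"
proof -
  have "indicator B k / \<nu> \<le> 1 / \<nu>" for B
    using nu by (intro divide_right_mono) (auto simp: indicator_def)
  then show ?thesis
    using stein_sol_diff_le[of A k] stein_sol_diff_le[of "- A" k]
    unfolding stein_sol_Compl by (smt (verit))
qed

lemma stein_sol_singleton_nonneg:
  assumes "j \<le> k"
  shows "0 \<le> stein_sol \<nu> {j} (Suc k)"
proof -
  have "{j} \<inter> {..<Suc k} = {j}" using assms by auto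
  then have "stein_sol \<nu> {j} (Suc k) = po j * (1 - Po {..<Suc k}) / (\<nu> * po k)"
    unfolding stein_sol_Suc by (simp add: measure_pmf_single algebra_simps del: pmf_poisson)
  then show ?thesis using nu by (simp del: pmf_poisson)
qed

text \<open>The increments for a singleton \<open>{j}\<close> are nonpositive except at \<open>j\<close>, and they add up to a value of the
solution beyond \<open>j\<close>, which is nonnegative. So their total variation is at most twice the increment at
\<open>j\<close>, that is \<open>2 / \<nu>\<close>, while each of them is at most \<open>1 / \<nu>\<close>.\<close>

lemma stein_sol_singleton_sum_squares:
  "(\<Sum>k<N. (stein_sol \<nu> {j} (Suc k) - stein_sol \<nu> {j} k)\<^sup>2) \<le> 2 / \<nu>\<^sup>2"
proof -
  define \<Delta> where "\<Delta> k = stein_sol \<nu> {j} (Suc k) - stein_sol \<nu> {j} k" for k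
  \<comment> \<open>A range that contains \<open>j\<close>; enlarging the range only increases the sum of squares.\<close>
  define M where "M = Suc (N + j)"
  have neg: "\<Delta> k \<le> 0" if "k \<noteq> j" for k
    using stein_sol_diff_le[of "{j}" k] that by (simp add: \<Delta>_def)
  have le: "\<bar>\<Delta> k\<bar> \<le> 1 / \<nu>" for k
    unfolding \<Delta>_def by (rule stein_sol_diff_abs_le)
  have "(\<Sum>k<M. \<Delta> k) = stein_sol \<nu> {j} M"
    unfolding \<Delta>_def by (subst sum_lessThan_telescope) simp
  also have "\<dots> \<ge> 0" unfolding M_def by (rule stein_sol_singleton_nonneg) simp
  finally have "0 \<le> \<Delta> j + (\<Sum>k\<in>{..<M}-{j}. \<Delta> k)"
    by (subst (asm) sum.remove[of _ j]) (auto simp: M_def)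
  moreover have "(\<Sum>k\<in>{..<M}-{j}. \<bar>\<Delta> k\<bar>) = - (\<Sum>k\<in>{..<M}-{j}. \<Delta> k)"
    unfolding sum_negf[symmetric] using neg by (intro sum.cong) auto
  ultimately have "(\<Sum>k<M. \<bar>\<Delta> k\<bar>) \<le> \<bar>\<Delta> j\<bar> + \<Delta> j"
    by (subst sum.remove[of _ j]) (auto simp: M_def)
  also have "\<dots> \<le> 2 / \<nu>" using le[of j] by linarith
  finally have tv: "(\<Sum>k<M. \<bar>\<Delta> k\<bar>) \<le> 2 / \<nu>" .
  have "(\<Sum>k<N. (\<Delta> k)\<^sup>2) \<le> (\<Sum>k<M. (\<Delta> k)\<^sup>2)"
    by (intro sum_mono2) (auto simp: M_def)
  also have "\<dots> \<le> (\<Sum>k<M. 1 / \<nu> * \<bar>\<Delta> k\<bar>)"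
  proof (intro sum_mono)
    fix k
    have "(\<Delta> k)\<^sup>2 = \<bar>\<Delta> k\<bar> * \<bar>\<Delta> k\<bar>" by (simp add: power2_eq_square)
    then show "(\<Delta> k)\<^sup>2 \<le> 1 / \<nu> * \<bar>\<Delta> k\<bar>"
      using le[of k] by (metis abs_ge_zero mult_right_mono)
  qed
  also have "\<dots> \<le> 1 / \<nu> * (2 / \<nu>)"
    unfolding sum_distrib_left[symmetric] using tv nu by (intro mult_left_mono) auto
  finally show ?thesis by (simp add: \<Delta>_def power2_eq_square)
qed

section \<open>Point probabilities of the Poisson law\<close>
text \<open>To the right of \<open>k \<le> \<nu>\<close> the point probabilities decay no faster than a Gaussian of variance of order \<open>\<nu>\<close>: the
ratio of the one at \<open>k + j\<close> to the one at \<open>k\<close> is at least \<open>exp (- j\<^sup>2 / \<nu>)\<close>. Hence at least \<open>sqrt \<nu>\<close> of them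
are no smaller than \<open>exp (-1)\<close> times the one at \<open>k\<close>, and they sum to at most one.\<close>

lemma poisson_pmf_le_mode:
  assumes "real k \<le> \<nu>"
  shows "po k \<le> exp 1 / sqrt \<nu>"
proof -
  have ratio: "exp (- (real j)\<^sup>2 / \<nu>) * po k \<le> po (k + j)" for j
  proof (induction j)
    case (Suc j)
    have "ln (real (Suc (k + j)) / \<nu>) \<le> real (Suc (k + j)) / \<nu> - 1"
      using nu by (intro ln_le_minus_one) simp
    also have "\<dots> = (real k - \<nu> + real j + 1) / \<nu>"
      using nu by (simp add: field_simps)
    also have "\<dots> \<le> (2 * real j + 1) / \<nu>"
      using assms nu by (intro divide_right_mono) auto
    finally have "exp (ln (real (Suc (k + j)) / \<nu>)) \<le> exp ((2 * real j + 1) / \<nu>)"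
      by (simp only: exp_le_cancel_iff)
    then have "real (Suc (k + j)) / \<nu> \<le> exp ((2 * real j + 1) / \<nu>)"
      using nu by (subst (asm) exp_ln) auto
    then have "inverse (exp ((2 * real j + 1) / \<nu>)) \<le> inverse (real (Suc (k + j)) / \<nu>)"
      using nu by (intro le_imp_inverse_le) auto
    then have step: "exp (- (2 * real j + 1) / \<nu>) \<le> \<nu> / real (Suc (k + j))"
      by (simp only: minus_divide_left[symmetric] exp_minus inverse_divide)
    have "exp (- (real (Suc j))\<^sup>2 / \<nu>) * po k
        = exp (- (2 * real j + 1) / \<nu>) * (exp (- (real j)\<^sup>2 / \<nu>) * po k)"
    proof -
      have "- (real (Suc j))\<^sup>2 = - (2 * real j + 1) + - (real j)\<^sup>2"
        by (simp add: power2_eq_square algebra_simps)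
      then show ?thesis by (simp only: add_divide_distrib exp_add mult.assoc)
    qed
    also have "\<dots> \<le> \<nu> / real (Suc (k + j)) * po (k + j)"
      using step Suc.IH nu by (intro mult_mono) (auto simp del: pmf_poisson)
    also have "\<dots> = po (k + Suc j)"
      using poisson_Suc[of "k + j"] by (simp add: field_simps del: pmf_poisson)
    finally show ?case .
  qed (simp del: pmf_poisson)
  \<comment> \<open>The window \<open>0, \<dots>, m\<close> has more than \<open>sqrt \<nu>\<close> points, and \<open>j\<^sup>2 \<le> \<nu>\<close> on it.\<close>
  define m where "m = nat \<lfloor>sqrt \<nu>\<rfloor>"
  have m: "sqrt \<nu> \<le> real (Suc m)" "real m \<le> sqrt \<nu>"
    using nu by (simp_all add: m_def) linarith
  have "sqrt \<nu> * (exp (-1) * po k) \<le> real (Suc m) * (exp (-1) * po k)"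
    using m nu by (intro mult_right_mono) auto
  also have "\<dots> = (\<Sum>j\<le>m. exp (-1) * po k)" by simp
  also have "\<dots> \<le> (\<Sum>j\<le>m. po (k + j))"
  proof (intro sum_mono)
    fix j assume "j \<in> {..m}"
    then have "real j \<le> sqrt \<nu>" using m by (auto intro: order_trans[rotated])
    then have "(real j)\<^sup>2 \<le> \<nu>" using nu by (simp add: real_le_rsqrt sqrt_ge_absD)
    then have "exp (-1) \<le> exp (- (real j)\<^sup>2 / \<nu>)" using nu by simp
    then have "exp (-1) * po k \<le> exp (- (real j)\<^sup>2 / \<nu>) * po k"
      by (intro mult_right_mono) auto
    then show "exp (-1) * po k \<le> po (k + j)" using ratio[of j] by linarith
  qed
  also have "\<dots> = Po ((+) k ` {..m})"
    by (simp add: measure_measure_pmf_finite sum.reindex del: pmf_poisson)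
  also have "\<dots> \<le> 1" by simp
  finally show ?thesis using nu by (simp add: exp_minus field_simps del: pmf_poisson)
qed

text \<open>Beyond \<open>\<nu>\<close> the point probabilities decrease, so the largest one lies in the range covered before.\<close>

lemma poisson_pmf_le: "po k \<le> exp 1 / sqrt \<nu>"
proof (induction k)
  case 0
  show ?case using nu by (intro poisson_pmf_le_mode) simp
next
  case (Suc k)
  show ?case
  proof (cases "real (Suc k) \<le> \<nu>")
    case True
    then show ?thesis by (rule poisson_pmf_le_mode)
  next
    case False
    have "real (Suc k) * po (Suc k) \<le> real (Suc k) * po k"
      unfolding poisson_Suc using False by (intro mult_right_mono) auto
    then have "po (Suc k) \<le> po k" by simp
    with Suc.IH show ?thesis by linarith
  qed
qed

end

lemma pmf_TP_le:
  assumes "0 < s"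
  shows "pmf (TP \<mu> s) k \<le> exp 1 / sqrt s"
proof -
  let ?\<nu> = "s + frac (\<mu> - s)" and ?m = "\<lfloor>\<mu> - s\<rfloor>"
  have nu: "s \<le> ?\<nu>" "0 < ?\<nu>" using assms frac_ge_0[of "\<mu> - s"] by linarith+
  have "pmf (TP \<mu> s) k = measure_pmf.prob (poisson_pmf ?\<nu>) ((\<lambda>y. int y + ?m) -` {k})"
    unfolding TP_def by (simp add: pmf_map)
  also have "\<dots> \<le> measure_pmf.prob (poisson_pmf ?\<nu>) {nat (k - ?m)}"
    by (intro measure_pmf.finite_measure_mono) auto
  also have "\<dots> \<le> exp 1 / sqrt ?\<nu>"
    unfolding measure_pmf_single using nu(2) by (rule poisson_pmf_le)
  also have "\<dots> \<le> exp 1 / sqrt s"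
    using nu assms by (intro divide_left_mono) auto
  finally show ?thesis .
qed

section \<open>Translated Poisson approximation from a Stein kernel\<close>

text \<open>The Stein solution for the Poisson law shifted by \<open>m\<close>. Below \<open>m\<close> it vanishes, so that there the Stein
operator returns \<open>0\<close> instead of the centred indicator of \<open>B\<close>.\<close>

definition tp_stein_sol :: "real \<Rightarrow> int \<Rightarrow> int set \<Rightarrow> int \<Rightarrow> real" where
  "tp_stein_sol \<nu> m B w =
     (if w < m then 0 else stein_sol \<nu> {y. int y + m \<in> B} (nat (w - m)))"

lemma tp_stein_sol_diff:
  "tp_stein_sol \<nu> m B (w + 1) - tp_stein_sol \<nu> m B w =
     (if w < m then 0
      else stein_sol \<nu> {y. int y + m \<in> B} (Suc (nat (w - m)))
         - stein_sol \<nu> {y. int y + m \<in> B} (nat (w - m)))"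
proof (cases "w < m")
  case True
  then have "w + 1 < m \<or> w + 1 = m" by linarith
  with True show ?thesis by (auto simp: tp_stein_sol_def)
next
  case False
  then have "nat (w + 1 - m) = Suc (nat (w - m))" by linarith
  with False show ?thesis by (simp add: tp_stein_sol_def)
qed

lemma tp_stein_sol_diff_abs_le:
  assumes "0 < \<nu>"
  shows "\<bar>tp_stein_sol \<nu> m B (w + 1) - tp_stein_sol \<nu> m B w\<bar> \<le> 1 / \<nu>"
  unfolding tp_stein_sol_diff using stein_sol_diff_abs_le[OF assms] assms by auto

lemma tp_stein_sol_singleton_sum_squares:
  assumes "0 < \<nu>" "finite K"
  shows "(\<Sum>w\<in>K. (tp_stein_sol \<nu> m {b} (w + 1) - tp_stein_sol \<nu> m {b} w)\<^sup>2) \<le> 2 / \<nu>\<^sup>2"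
    (is "(\<Sum>w\<in>K. (?D w)\<^sup>2) \<le> _")
proof -
  define A where "A = {y. int y + m \<in> {b}}"
  have "(\<Sum>w\<in>K. (?D w)\<^sup>2) = (\<Sum>w\<in>{w\<in>K. m \<le> w}. (?D w)\<^sup>2)"
    using assms(2) by (intro sum.mono_neutral_right) (auto simp: tp_stein_sol_diff)
  also have "\<dots> = (\<Sum>k\<in>(\<lambda>w. nat (w - m)) ` {w\<in>K. m \<le> w}.
                    (stein_sol \<nu> A (Suc k) - stein_sol \<nu> A k)\<^sup>2)"
    by (subst sum.reindex) (auto simp: inj_on_def tp_stein_sol_diff A_def intro!: sum.cong)
  also have "\<dots> \<le> (\<Sum>k<Suc (Max (insert 0 ((\<lambda>w. nat (w - m)) ` {w\<in>K. m \<le> w}))).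
                    (stein_sol \<nu> A (Suc k) - stein_sol \<nu> A k)\<^sup>2)"
    using assms(2) by (intro sum_mono2) (auto simp: less_Suc_eq_le intro!: Max_ge)
  also have "\<dots> \<le> 2 / \<nu>\<^sup>2"
  proof (cases "b < m")
    case True
    then have "A = {}" by (auto simp: A_def)
    then show ?thesis by simp
  next
    case False
    then have "A = {nat (b - m)}" by (auto simp: A_def)
    then show ?thesis
      by (simp only: stein_sol_singleton_sum_squares[OF assms(1)])
  qed
  finally show ?thesis .
qed

text \<open>A discrete Stein kernel \<open>\<tau>\<close> for a law on the integers. The constant \<open>g\<close> shows that \<open>\<mu>\<close> is the mean, and
\<open>g w = w - \<mu>\<close> that \<open>s\<close> is the mean of \<open>\<tau>\<close>. For translates of Poisson laws the identity holds with constant \<open>\<tau>\<close>.\<close>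

locale stein_kernel =
  fixes P :: "int pmf" and \<mu> s :: real and \<tau> :: "int \<Rightarrow> real"
  assumes finite_support: "finite (set_pmf P)"
    and kernel: "measure_pmf.expectation P (\<lambda>w. (real_of_int w - \<mu>) * g w)
               = measure_pmf.expectation P (\<lambda>w. \<tau> w * (g (w + 1) - g w))"
    and variance_eq_s: "measure_pmf.variance P real_of_int = s"
    and s_pos: "0 < s"
begin

abbreviation (input) "E \<equiv> measure_pmf.expectation P"

lemma integrable_support [simp]: "integrable (measure_pmf P) f" for f :: "int \<Rightarrow> real"
  using finite_support by (rule integrable_measure_pmf_finite)

lemma mean_eq: "E real_of_int = \<mu>"
  using kernel[of "\<lambda>_. 1"] by simp

lemma kernel_mean: "E \<tau> = s"
  using kernel[of "\<lambda>w. real_of_int w - \<mu>"] variance_eq_s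
  by (simp add: mean_eq power2_eq_square)

definition "\<nu> = s + frac (\<mu> - s)"
definition "m = \<lfloor>\<mu> - s\<rfloor>"

lemma s_le_nu: "s \<le> \<nu>" and nu_le: "\<nu> \<le> s + 1" and nu_pos: "0 < \<nu>" and m_eq: "real_of_int m = \<mu> - \<nu>"
  using s_pos frac_ge_0[of "\<mu> - s"] frac_lt_1[of "\<mu> - s"]
  unfolding \<nu>_def m_def frac_def by linarith+

lemma TP_eq: "TP \<mu> s = map_pmf (\<lambda>y. int y + m) (poisson_pmf \<nu>)"
  by (simp add: TP_def \<nu>_def m_def)

text \<open>Chebyshev's inequality: \<open>m = \<mu> - \<nu>\<close> lies at distance \<open>\<nu> \<ge> s\<close> from the mean.\<close>

lemma lower_tail: "measure_pmf.prob P {w. w < m} \<le> 1 / s"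
proof -
  have "measure_pmf.prob P {w. w < m} \<le> measure_pmf.prob P {w. \<bar>real_of_int w - E real_of_int\<bar> \<ge> \<nu>}"
  proof (intro measure_pmf.finite_measure_mono subsetI)
    fix w assume "w \<in> {w. w < m}"
    then have "real_of_int w < \<mu> - \<nu>" using m_eq by (metis mem_Collect_eq of_int_less_iff)
    then show "w \<in> {w. \<bar>real_of_int w - E real_of_int\<bar> \<ge> \<nu>}" by (simp add: mean_eq)
  qed simp
  also have "\<dots> \<le> s / \<nu>\<^sup>2"
    using measure_pmf.Chebyshev_inequality[of real_of_int P \<nu>] nu_pos by (simp add: variance_eq_s)
  also have "\<dots> \<le> s / s\<^sup>2"
    using s_le_nu s_pos by (intro divide_left_mono power_mono) (auto intro!: mult_pos_pos)
  also have "\<dots> = 1 / s" using s_pos by (simp add: power2_eq_square)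
  finally show ?thesis .
qed

abbreviation (input) "\<Delta> B w \<equiv> tp_stein_sol \<nu> m B (w + 1) - tp_stein_sol \<nu> m B w"

lemma Delta_le: "\<bar>\<Delta> B w\<bar> \<le> 1 / s"
proof -
  have "1 / \<nu> \<le> 1 / s" using s_le_nu s_pos by (intro divide_left_mono) auto
  then show ?thesis using tp_stein_sol_diff_abs_le[OF nu_pos, of m B w] by linarith
qed

text \<open>Integrating the Stein equation against \<open>P\<close> and inserting the kernel identity leaves \<open>(\<nu> - \<tau>) \<Delta>g\<close>. Of this,
\<open>(s - \<tau>) \<Delta>g\<close> is the main term and \<open>(\<nu> - s) \<Delta>g\<close> the rounding term, at most \<open>1 / s\<close>. The points below \<open>m\<close>, where
the Stein equation fails, cost another \<open>1 / s\<close>.\<close>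

lemma prob_diff_le:
  "\<bar>measure_pmf.prob P B - measure_pmf.prob (TP \<mu> s) B\<bar>
     \<le> E (\<lambda>w. \<bar>\<tau> w - s\<bar> * \<bar>\<Delta> B w\<bar>) + 2 / s"
proof -
  let ?G = "tp_stein_sol \<nu> m B"
  define A where "A = {y. int y + m \<in> B}"
  define q where "q = measure_pmf.prob (poisson_pmf \<nu>) A"
  have q: "measure_pmf.prob (TP \<mu> s) B = q"
    unfolding TP_eq q_def A_def by (simp add: vimage_def)
  have q01: "0 \<le> q" "q \<le> 1" by (simp_all add: q_def)
  have pw: "indicator B w - q = (\<nu> * \<Delta> B w - (real_of_int w - \<mu>) * ?G w)
              + indicator {w. w < m} w * (indicator B w - q)" for w
  proof (cases "w < m")
    case True
    then show ?thesis by (simp add: tp_stein_sol_diff) (simp add: tp_stein_sol_def)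
  next
    case False
    have "\<nu> * stein_sol \<nu> A (Suc (nat (w - m))) - real (nat (w - m)) * stein_sol \<nu> A (nat (w - m))
            = indicator A (nat (w - m)) - q"
      unfolding q_def by (rule stein_equation[OF nu_pos])
    moreover have "real (nat (w - m)) = (real_of_int w - \<mu>) + \<nu>"
      using False m_eq by simp
    moreover have "indicator A (nat (w - m)) = (indicator B w :: real)"
      using False by (simp add: A_def indicator_def)
    moreover have "?G w = stein_sol \<nu> A (nat (w - m))"
      using False by (simp add: tp_stein_sol_def A_def)
    moreover have "\<Delta> B w = stein_sol \<nu> A (Suc (nat (w - m))) - stein_sol \<nu> A (nat (w - m))"
      using False by (simp only: tp_stein_sol_diff A_def if_False)
    ultimately show ?thesis
      using False by (simp only: indicator_simps mem_Collect_eq) (simp add: algebra_simps)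
  qed
  have "measure_pmf.prob P B - q = E (\<lambda>w. indicator B w - q)"
    by simp
  also have "\<dots> = E (\<lambda>w. (\<nu> * \<Delta> B w - (real_of_int w - \<mu>) * ?G w)
              + indicator {w. w < m} w * (indicator B w - q))"
    by (simp add: pw[symmetric])
  also have "\<dots> = E (\<lambda>w. \<nu> * \<Delta> B w) - E (\<lambda>w. (real_of_int w - \<mu>) * ?G w)
              + E (\<lambda>w. indicator {w. w < m} w * (indicator B w - q))"
    by (simp only: Bochner_Integration.integral_add Bochner_Integration.integral_diff integrable_support)
  also have "E (\<lambda>w. \<nu> * \<Delta> B w) - E (\<lambda>w. (real_of_int w - \<mu>) * ?G w)
      = E (\<lambda>w. (s - \<tau> w) * \<Delta> B w) + E (\<lambda>w. (\<nu> - s) * \<Delta> B w)"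
    unfolding kernel
    by (simp only: Bochner_Integration.integral_add[symmetric]
        Bochner_Integration.integral_diff[symmetric] integrable_support)
       (simp add: algebra_simps)
  finally have "\<bar>measure_pmf.prob P B - q\<bar>
     \<le> \<bar>E (\<lambda>w. (s - \<tau> w) * \<Delta> B w)\<bar> + \<bar>E (\<lambda>w. (\<nu> - s) * \<Delta> B w)\<bar>
        + \<bar>E (\<lambda>w. indicator {w. w < m} w * (indicator B w - q))\<bar>"
    by linarith
  moreover have "\<bar>E (\<lambda>w. (s - \<tau> w) * \<Delta> B w)\<bar> \<le> E (\<lambda>w. \<bar>\<tau> w - s\<bar> * \<bar>\<Delta> B w\<bar>)"
    using integral_abs_bound[of P "\<lambda>w. (s - \<tau> w) * \<Delta> B w"]
    by (simp add: abs_mult abs_minus_commute)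
  moreover have "\<bar>E (\<lambda>w. (\<nu> - s) * \<Delta> B w)\<bar> \<le> 1 / s"
  proof -
    have "\<bar>E (\<lambda>w. (\<nu> - s) * \<Delta> B w)\<bar> \<le> E (\<lambda>w. \<bar>(\<nu> - s) * \<Delta> B w\<bar>)"
      by (rule integral_abs_bound)
    also have "\<dots> \<le> E (\<lambda>w. 1 / s)"
    proof (intro integral_mono)
      fix w
      have "\<bar>\<nu> - s\<bar> * \<bar>\<Delta> B w\<bar> \<le> 1 * (1 / s)"
        using Delta_le[of B w] s_le_nu nu_le by (intro mult_mono) auto
      then show "\<bar>(\<nu> - s) * \<Delta> B w\<bar> \<le> 1 / s" by (simp add: abs_mult)
    qed simp_all
    finally show ?thesis by simp
  qed
  moreover have "\<bar>E (\<lambda>w. indicator {w. w < m} w * (indicator B w - q))\<bar> \<le> 1 / s"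
  proof -
    have "\<bar>E (\<lambda>w. indicator {w. w < m} w * (indicator B w - q))\<bar>
        \<le> E (\<lambda>w. \<bar>indicator {w. w < m} w * (indicator B w - q)\<bar>)"
      by (rule integral_abs_bound)
    also have "\<dots> \<le> E (indicator {w. w < m})"
      using q01 by (intro integral_mono) (auto simp: indicator_def)
    also have "\<dots> \<le> 1 / s" using lower_tail by simp
    finally show ?thesis .
  qed
  ultimately show ?thesis unfolding q by simp
qed

lemma main_term_le:
  assumes "E (\<lambda>w. (\<Delta> B w)\<^sup>2) \<le> c"
  shows "E (\<lambda>w. \<bar>\<tau> w - s\<bar> * \<bar>\<Delta> B w\<bar>) \<le> sqrt (measure_pmf.variance P \<tau>) * sqrt c"
proof -
  have "E (\<lambda>w. \<bar>\<tau> w - s\<bar> * \<bar>\<Delta> B w\<bar>) \<le> sqrt (E (\<lambda>w. (\<tau> w - s)\<^sup>2)) * sqrt (E (\<lambda>w. (\<Delta> B w)\<^sup>2))"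
    using expectation_Cauchy_Schwarz[OF finite_support, of "\<lambda>w. \<bar>\<tau> w - s\<bar>" "\<lambda>w. \<bar>\<Delta> B w\<bar>"]
    by simp
  also have "\<dots> \<le> sqrt (E (\<lambda>w. (\<tau> w - s)\<^sup>2)) * sqrt c"
    using assms by (intro mult_left_mono) auto
  finally show ?thesis by (simp add: kernel_mean)
qed

theorem d_TV_TP_le:
  "d_TV P (TP \<mu> s) \<le> sqrt (measure_pmf.variance P \<tau>) / s + 2 / s"
  unfolding d_TV_def
proof (rule cSUP_least)
  fix B
  have "E (\<lambda>w. (\<Delta> B w)\<^sup>2) \<le> E (\<lambda>_. (1 / s)\<^sup>2)"
  proof (intro integral_mono)
    fix w show "(\<Delta> B w)\<^sup>2 \<le> (1 / s)\<^sup>2"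
      using Delta_le[of B w] s_pos by (subst abs_le_square_iff[symmetric]) simp
  qed simp_all
  from main_term_le[OF this] s_pos
  have "E (\<lambda>w. \<bar>\<tau> w - s\<bar> * \<bar>\<Delta> B w\<bar>) \<le> sqrt (measure_pmf.variance P \<tau>) / s"
    by simp
  then show "\<bar>measure_pmf.prob P B - measure_pmf.prob (TP \<mu> s) B\<bar>
      \<le> sqrt (measure_pmf.variance P \<tau>) / s + 2 / s"
    using prob_diff_le[of B] by linarith
qed simp

text \<open>For a singleton test set the increments are square summable over the integers, so the mean of their
squares gains the factor \<open>q\<close> over the uniform bound.\<close>

theorem d_loc_TP_le:
  assumes q: "\<And>k. pmf P k \<le> q"
  shows "d_loc P (TP \<mu> s) \<le> 2 * sqrt (q * measure_pmf.variance P \<tau>) / s + 2 / s"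
  unfolding d_loc_def
proof (rule cSUP_least)
  fix b
  have q0: "0 \<le> q" using q[of 0] pmf_nonneg[of P 0] by linarith
  have v0: "0 \<le> measure_pmf.variance P \<tau>" by simp
  have "E (\<lambda>w. (\<Delta> {b} w)\<^sup>2) = (\<Sum>w\<in>set_pmf P. (\<Delta> {b} w)\<^sup>2 * pmf P w)"
    using finite_support by (intro integral_measure_pmf_real) auto
  also have "\<dots> \<le> (\<Sum>w\<in>set_pmf P. (\<Delta> {b} w)\<^sup>2 * q)"
    by (intro sum_mono mult_left_mono q) simp
  also have "\<dots> \<le> 2 / \<nu>\<^sup>2 * q"
    unfolding sum_distrib_right[symmetric]
    by (intro mult_right_mono tp_stein_sol_singleton_sum_squares nu_pos finite_support q0)
  also have "\<dots> \<le> 2 / s\<^sup>2 * q"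
    using s_le_nu s_pos q0 by (intro mult_right_mono divide_left_mono power_mono) auto
  also have "\<dots> \<le> 4 * q / s\<^sup>2" using q0 by (simp add: divide_right_mono)
  finally have "E (\<lambda>w. \<bar>\<tau> w - s\<bar> * \<bar>\<Delta> {b} w\<bar>)
     \<le> sqrt (measure_pmf.variance P \<tau>) * sqrt (4 * q / s\<^sup>2)"
    by (rule main_term_le)
  also have "sqrt (4 * q / s\<^sup>2) = 2 * sqrt q / s"
    using s_pos by (simp add: real_sqrt_divide real_sqrt_mult)
  also have "sqrt (measure_pmf.variance P \<tau>) * (2 * sqrt q / s)
      = 2 * sqrt (q * measure_pmf.variance P \<tau>) / s"
    by (simp add: real_sqrt_mult)
  finally show "\<bar>pmf P b - pmf (TP \<mu> s) b\<bar> \<le> 2 * sqrt (q * measure_pmf.variance P \<tau>) / s + 2 / s"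
    using prob_diff_le[of "{b}"] by (simp only: measure_pmf_single)
qed simp

end

text \<open>The factor \<open>3\<close> is a convenient upper bound for \<open>2 powr (3/2)\<close>.\<close>

lemma powr_three_halves_add_le:
  fixes a b :: real
  assumes "0 \<le> a" "0 \<le> b"
  shows "(a + b) powr (3/2) \<le> 3 * (a powr (3/2) + b powr (3/2))"
proof -
  have "(a + b) powr (3/2) \<le> (2 * max a b) powr (3/2)"
    using assms by (intro powr_mono2) auto
  also have "\<dots> = 2 powr (3/2) * max a b powr (3/2)"
    using assms by (intro powr_mult)
  also have "\<dots> \<le> 3 * (a powr (3/2) + b powr (3/2))"
  proof (intro mult_mono)
    have "(2 powr (3/2))\<^sup>2 = (2 powr 3 :: real)"
      by (simp add: power2_eq_square flip: powr_add)
    also have "\<dots> \<le> 3\<^sup>2" by simp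
    finally show "2 powr (3/2) \<le> (3 :: real)"
      by (rule power2_le_imp_le) simp
    show "max a b powr (3/2) \<le> a powr (3/2) + b powr (3/2)"
      by (auto simp: max_def)
  qed simp_all
  finally show ?thesis .
qed

section \<open>The anti-voter chain in equilibrium\<close>

locale anti_voter = pair_graph G for G :: "'a pair_pre_digraph" +
  fixes r :: nat and \<pi> :: "('a \<Rightarrow> int) pmf"
  assumes regular: "regular_graph G r"
    and not_bipartite: "\<not> bipartite_graph G"
    and equilibrium: "anti_voter_equilibrium G \<pi>"
begin

abbreviation (input) "V \<equiv> pverts G"
abbreviation (input) "N \<equiv> neighbours G"
abbreviation (input) "E \<equiv> measure_pmf.expectation \<pi>"
abbreviation "n \<equiv> real (card (pverts G))"

lemma finite_V [simp]: "finite V" by (rule pair_finite_verts)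

lemma finite_parcs [simp]: "finite (parcs G)" by (rule pair_finite_arcs)

lemma N_subset: "N i \<subseteq> V"
  by (auto simp: neighbours_def dest: in_arcsD2)

lemma finite_N [simp]: "finite (N i)"
  using N_subset finite_V by (rule finite_subset)

lemma card_N: "i \<in> V \<Longrightarrow> card (N i) = r"
  using regular by (simp add: regular_graph_def)

lemma arc_sym: "(i, j) \<in> parcs G \<Longrightarrow> (j, i) \<in> parcs G"
  using pair_sym_arcs by (auto simp: symmetric_def sym_def)

lemma arc_in_V: "(i, j) \<in> parcs G \<Longrightarrow> i \<in> V" "(i, j) \<in> parcs G \<Longrightarrow> j \<in> V"
  by (auto dest: in_arcsD1 in_arcsD2)

lemma parcs_eq: "parcs G = Sigma V N"
  by (auto simp: neighbours_def dest: in_arcsD1)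

lemma parcs_nonempty: "parcs G \<noteq> {}"
  using not_bipartite by (auto simp: bipartite_graph_def)

lemma V_nonempty [simp]: "V \<noteq> {}"
  using parcs_nonempty by (auto simp: parcs_eq)

lemma r_pos [simp]: "0 < r"
proof -
  obtain i j where "(i, j) \<in> parcs G" using parcs_nonempty by auto
  then have "i \<in> V" "j \<in> N i" by (auto simp: neighbours_def dest: in_arcsD1)
  then show ?thesis using card_N[of i] by (metis card_gt_0_iff empty_iff finite_N)
qed

lemma r_nonzero [simp]: "r \<noteq> 0"
  using r_pos by (rule gr_implies_not0)

lemma n_pos: "0 < n"
  using V_nonempty by (simp add: card_gt_0_iff)

lemma N_nonempty: "i \<in> V \<Longrightarrow> N i \<noteq> {}"
  using card_N r_pos by fastforce

text \<open>A step of the chain chooses an arc: by regularity, a uniform vertex followed by a uniform neighbour is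
a uniformly chosen arc. Sums over arcs are invariant under reversal of all arcs, which is how regularity
and symmetry of the graph enter.\<close>

abbreviation arc_sum :: "('a \<Rightarrow> 'a \<Rightarrow> real) \<Rightarrow> real" where
  "arc_sum f \<equiv> (\<Sum>(i, j)\<in>parcs G. f i j)"

lemma arc_sum_nested: "arc_sum f = (\<Sum>i\<in>V. \<Sum>j\<in>N i. f i j)"
  unfolding parcs_eq by (simp add: sum.Sigma)

lemma arc_sum_swap: "arc_sum f = arc_sum (\<lambda>i j. f j i)"
  by (rule sum.reindex_bij_witness[of _ prod.swap prod.swap]) (auto intro: arc_sym)

lemma arc_sum_fst: "arc_sum (\<lambda>i j. f i) = real r * (\<Sum>i\<in>V. f i)"
  by (simp add: arc_sum_nested card_N sum_distrib_left)

lemma arc_sum_snd: "arc_sum (\<lambda>i j. f j) = real r * (\<Sum>i\<in>V. f i)"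
  by (subst arc_sum_swap) (rule arc_sum_fst)

lemma arc_sum_const: "arc_sum (\<lambda>i j. c) = n * real r * c"
  using arc_sum_fst[of "\<lambda>_. c"] by (simp add: mult_ac)

lemma finite_support: "finite (set_pmf \<pi>)"
proof -
  have "set_pmf \<pi> \<subseteq> V \<rightarrow>\<^sub>E {0, 1}"
    using equilibrium by (simp add: anti_voter_equilibrium_def opinion_states_def)
  then show ?thesis by (rule finite_subset) (simp add: finite_PiE)
qed

lemma integrable_support [simp]: "integrable (measure_pmf \<pi>) f" for f :: "_ \<Rightarrow> real"
  using finite_support by (rule integrable_measure_pmf_finite)

lemma opinion_cases:
  assumes "J \<in> set_pmf \<pi>" "i \<in> V"
  shows "J i = 0 \<or> J i = 1"
  using equilibrium assms
  by (auto simp: anti_voter_equilibrium_def opinion_states_def PiE_def Pi_def)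

lemma E_eq_sum: "E f = (\<Sum>J\<in>set_pmf \<pi>. pmf \<pi> J * f J)" for f :: "_ \<Rightarrow> real"
  using integral_measure_pmf_real[OF finite_support, of \<pi> f] by (simp add: mult.commute)

lemma E_cong: "(\<And>J. J \<in> set_pmf \<pi> \<Longrightarrow> f J = g J) \<Longrightarrow> E f = (E g :: real)"
  by (intro integral_cong_AE) (auto simp: AE_measure_pmf_iff)

lemma E_sum: "E (\<lambda>J. \<Sum>a\<in>A. f a J) = (\<Sum>a\<in>A. E (f a))" for f :: "_ \<Rightarrow> _ \<Rightarrow> real"
  by (rule Bochner_Integration.integral_sum) simp

lemma E_zeroD:
  fixes f :: "_ \<Rightarrow> real"
  assumes "E f = 0" "\<And>J. J \<in> set_pmf \<pi> \<Longrightarrow> 0 \<le> f J" "J \<in> set_pmf \<pi>"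
  shows "f J = 0"
proof -
  have "AE J in measure_pmf \<pi>. f J = 0"
    using assms(1,2) by (subst integral_nonneg_eq_0_iff_AE[symmetric]) (auto simp: AE_measure_pmf_iff)
  then show ?thesis using assms(3) by (simp add: AE_measure_pmf_iff)
qed

abbreviation update :: "('a \<Rightarrow> int) \<Rightarrow> 'a \<Rightarrow> 'a \<Rightarrow> 'a \<Rightarrow> int" where
  "update J i j \<equiv> J(i := 1 - J j)"

lemma step_expectation:
  fixes h :: "_ \<Rightarrow> real"
  shows "measure_pmf.expectation (anti_voter_step G J) h
     = arc_sum (\<lambda>i j. h (update J i j)) / (n * real r)"
proof -
  have inner: "measure_pmf.expectation (pmf_of_set (N i) \<bind> (\<lambda>j. return_pmf (update J i j))) h
      = (\<Sum>j\<in>N i. h (update J i j)) / real r" if "i \<in> V" for i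
    using that N_nonempty[of i]
    by (subst pmf_expectation_bind_pmf_of_set)
       (auto simp: card_N divide_inverse sum_distrib_left mult.commute)
  have "finite (set_pmf (pmf_of_set (N i) \<bind> (\<lambda>j. return_pmf (update J i j))))" if "i \<in> V" for i
    using that N_nonempty[of i] by (simp add: set_pmf_of_set)
  then have "measure_pmf.expectation (anti_voter_step G J) h
      = (\<Sum>i\<in>V. (\<Sum>j\<in>N i. h (update J i j)) / real r) / n"
    unfolding anti_voter_step_def using V_nonempty
    by (subst pmf_expectation_bind_pmf_of_set)
       (auto simp: inner divide_inverse sum_distrib_left mult.commute intro!: sum.cong)
  then show ?thesis
    by (simp add: arc_sum_nested sum_divide_distrib[symmetric] mult.commute)
qed

lemma finite_step: "finite (set_pmf (anti_voter_step G J))"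
  unfolding anti_voter_step_def using V_nonempty N_nonempty by (simp add: set_pmf_of_set)

lemma pair_expectation:
  fixes h :: "_ \<Rightarrow> real"
  shows "measure_pmf.expectation (anti_voter_pair G \<pi>) h
     = E (\<lambda>J. arc_sum (\<lambda>i j. h (J, update J i j)) / (n * real r))"
  unfolding anti_voter_pair_def
  by (subst pmf_expectation_bind[OF finite_support])
     (simp_all add: finite_step step_expectation E_eq_sum sum_divide_distrib)

text \<open>Stationarity in the form in which it is used throughout: every function has mean drift zero.\<close>

lemma generator_zero:
  fixes h :: "_ \<Rightarrow> real"
  shows "E (\<lambda>J. arc_sum (\<lambda>i j. h (update J i j) - h J)) = 0"
proof -
  have "E h = measure_pmf.expectation (\<pi> \<bind> anti_voter_step G) h"
    using equilibrium by (simp add: anti_voter_equilibrium_def)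
  also have "\<dots> = E (\<lambda>J. arc_sum (\<lambda>i j. h (update J i j)) / (n * real r))"
    by (subst pmf_expectation_bind[OF finite_support])
       (simp_all add: finite_step step_expectation E_eq_sum sum_divide_distrib)
  finally have "E (\<lambda>J. arc_sum (\<lambda>i j. h (update J i j))) = n * real r * E h"
    using n_pos r_pos by (simp add: field_simps)
  moreover have "arc_sum (\<lambda>i j. h (update J i j) - h J)
      = arc_sum (\<lambda>i j. h (update J i j)) - n * real r * h J" for J
    using arc_sum_const[of "h J"] by (simp add: case_prod_unfold sum_subtractf)
  ultimately show ?thesis by simp
qed

abbreviation "W J \<equiv> av_W G J"
abbreviation "x J i \<equiv> real_of_int (J i)"

lemma W_update: "i \<in> V \<Longrightarrow> W (update J i j) = W J + (1 - J i - J j)"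
proof -
  assume i: "i \<in> V"
  have "(\<Sum>k\<in>V - {i}. (update J i j) k) = (\<Sum>k\<in>V - {i}. J k)"
    by (intro sum.cong) auto
  then show ?thesis using i by (simp add: av_W_def sum.remove[of V i])
qed

lemma W_ge: "J \<in> set_pmf \<pi> \<Longrightarrow> i \<in> V \<Longrightarrow> J i \<le> W J"
proof -
  assume J: "J \<in> set_pmf \<pi>" and i: "i \<in> V"
  have "0 \<le> (\<Sum>k\<in>V - {i}. J k)"
    using opinion_cases[OF J] by (intro sum_nonneg) fastforce
  then show ?thesis using i by (simp add: av_W_def sum.remove[of V i])
qed

lemma W_nonneg: "J \<in> set_pmf \<pi> \<Longrightarrow> 0 \<le> W J"
  using W_ge opinion_cases V_nonempty by fastforce

text \<open>The conditional probabilities, given the state, of a step of \<open>W\<close> upwards and downwards: \<open>W\<close> increases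
exactly when both ends of the chosen arc hold opinion \<open>0\<close>.\<close>

definition up :: "('a \<Rightarrow> int) \<Rightarrow> real" where
  "up J = arc_sum (\<lambda>i j. (1 - x J i) * (1 - x J j)) / (n * real r)"

definition down :: "('a \<Rightarrow> int) \<Rightarrow> real" where
  "down J = arc_sum (\<lambda>i j. x J i * x J j) / (n * real r)"

lemma arc_sum_up: "arc_sum (\<lambda>i j. (1 - x J i) * (1 - x J j)) = n * real r * up J"
  and arc_sum_down: "arc_sum (\<lambda>i j. x J i * x J j) = n * real r * down J"
  using V_nonempty r_pos by (simp_all add: up_def down_def)

lemma up_minus_down: "up J - down J = - (2 / n) * (real_of_int (W J) - n / 2)"
proof -
  have "n * real r * up J - n * real r * down J = arc_sum (\<lambda>i j. 1 - x J i - x J j)"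
    unfolding arc_sum_up[symmetric] arc_sum_down[symmetric]
    by (subst sum_subtractf[symmetric]) (auto intro!: sum.cong simp: algebra_simps)
  also have "\<dots> = arc_sum (\<lambda>i j. 1) - arc_sum (\<lambda>i j. x J i) - arc_sum (\<lambda>i j. x J j)"
    by (simp add: case_prod_unfold sum_subtractf)
  also have "\<dots> = n * real r - 2 * real r * real_of_int (W J)"
    unfolding arc_sum_const arc_sum_fst arc_sum_snd by (simp add: av_W_def)
  finally have "real r * (n * (up J - down J)) = real r * (n - 2 * real_of_int (W J))"
    by (simp add: algebra_simps)
  then have "n * (up J - down J) = n - 2 * real_of_int (W J)" using r_pos by simp
  then have "up J - down J = (n - 2 * real_of_int (W J)) / n"
    using n_pos by (simp add: eq_divide_eq mult.commute)
  then show ?thesis using n_pos by (simp add: diff_divide_distrib algebra_simps)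
qed

lemma up_nonneg: "J \<in> set_pmf \<pi> \<Longrightarrow> 0 \<le> up J"
  and down_nonneg: "J \<in> set_pmf \<pi> \<Longrightarrow> 0 \<le> down J"
  unfolding up_def down_def
  using opinion_cases[of J] arc_in_V n_pos
  by (fastforce intro!: divide_nonneg_nonneg sum_nonneg mult_nonneg_nonneg)+

text \<open>The flow across each edge of the path graph on the integers balances because \<open>W\<close> cannot jump over a
point. Instead of cutting at a level, apply stationarity to a discrete antiderivative of \<open>g\<close>.\<close>

lemma detailed_balance:
  "E (\<lambda>J. up J * g (W J)) = E (\<lambda>J. down J * g (W J - 1))"
proof -
  \<comment> \<open>\<open>W\<close> is nonnegative on the support, so the antiderivative is needed on nonnegative integers only.\<close>
  define H where "H w = (\<Sum>k\<in>{0..<w}. g k)" for w :: int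
  have Hup: "H (w + 1) - H w = g w" if "0 \<le> w" for w
  proof -
    have "{0..<w + 1} = insert w {0..<w}" using that by auto
    then show ?thesis by (simp add: H_def)
  qed
  have Hdown: "H (w - 1) - H w = - g (w - 1)" if "1 \<le> w" for w
    using Hup[of "w - 1"] that by simp
  have "arc_sum (\<lambda>i j. H (W (update J i j)) - H (W J))
      = n * real r * (up J * g (W J) - down J * g (W J - 1))" if J: "J \<in> set_pmf \<pi>" for J
  proof -
    have "H (W (update J i j)) - H (W J)
        = (1 - x J i) * (1 - x J j) * g (W J) - x J i * x J j * g (W J - 1)"
      if "(i, j) \<in> parcs G" for i j
    proof -
      have V: "i \<in> V" "j \<in> V" using that arc_in_V by auto
      show ?thesis
        using opinion_cases[OF J V(1)] opinion_cases[OF J V(2)] W_ge[OF J V(1)] W_nonneg[OF J]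
        by (auto simp: W_update[OF V(1)] Hup Hdown)
    qed
    then have "arc_sum (\<lambda>i j. H (W (update J i j)) - H (W J))
       = arc_sum (\<lambda>i j. (1 - x J i) * (1 - x J j) * g (W J) - x J i * x J j * g (W J - 1))"
      by (intro sum.cong) auto
    also have "\<dots> = arc_sum (\<lambda>i j. (1 - x J i) * (1 - x J j)) * g (W J)
        - arc_sum (\<lambda>i j. x J i * x J j) * g (W J - 1)"
      by (simp add: case_prod_unfold sum_subtractf sum_distrib_right)
    finally show ?thesis unfolding arc_sum_up arc_sum_down by (simp add: algebra_simps)
  qed
  then have "E (\<lambda>J. n * real r * (up J * g (W J) - down J * g (W J - 1))) = 0"
    using generator_zero[of "\<lambda>J. H (W J)"] by (simp cong: E_cong)
  then show ?thesis using n_pos r_pos by simp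
qed

text \<open>The linear drift expresses \<open>W - n / 2\<close> through \<open>down - up\<close>, and detailed balance shifts the argument of \<open>g\<close> in
the downward part, leaving an increment of \<open>g\<close>.\<close>

lemma up_kernel:
  "E (\<lambda>J. (real_of_int (W J) - n / 2) * g (W J)) = n / 2 * E (\<lambda>J. up J * (g (W J + 1) - g (W J)))"
proof -
  have "E (\<lambda>J. up J * (g (W J + 1) - g (W J))) = E (\<lambda>J. up J * g (W J + 1)) - E (\<lambda>J. up J * g (W J))"
    by (simp add: algebra_simps)
  also have "E (\<lambda>J. up J * g (W J + 1)) = E (\<lambda>J. down J * g (W J))"
    using detailed_balance[of "\<lambda>w. g (w + 1)"] by simp
  also have "\<dots> - E (\<lambda>J. up J * g (W J)) = - E (\<lambda>J. (up J - down J) * g (W J))"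
    by (simp add: algebra_simps)
  also have "\<dots> = (2 / n) * E (\<lambda>J. (real_of_int (W J) - n / 2) * g (W J))"
    by (simp only: up_minus_down mult.assoc integral_mult_right_zero mult_minus_left Bochner_Integration.integral_minus
        minus_minus)
  finally show ?thesis using n_pos by simp
qed

lemma mean_W: "mean_W G \<pi> = n / 2"
  using up_kernel[of "\<lambda>_. 1"] by (simp add: mean_W_def)

lemma var_W_eq_up: "var_W G \<pi> = n / 2 * E up"
  unfolding var_W_def mean_W[unfolded mean_W_def] power2_eq_square
  using up_kernel[of "\<lambda>w. real_of_int w - n / 2"] by simp

text \<open>If the variance vanished, the mean probability of a step up would vanish, and by detailed balance
also that of a step down. Then every state in the support gives opposite opinions to the ends of every
arc and is a two-colouring of \<open>G\<close>.\<close>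

lemma var_W_pos: "0 < var_W G \<pi>"
proof (rule ccontr)
  assume "\<not> 0 < var_W G \<pi>"
  moreover have "0 \<le> E up"
    by (intro integral_nonneg_AE) (auto simp: AE_measure_pmf_iff up_nonneg)
  ultimately have up0: "E up = 0"
    using n_pos mult_pos_pos[of "n / 2" "E up"] unfolding var_W_eq_up by fastforce
  have "E down = 0"
    using detailed_balance[of "\<lambda>_. 1"] up0 by simp
  obtain J where J: "J \<in> set_pmf \<pi>" using set_pmf_not_empty[of \<pi>] by blast
  have V: "J i = 0 \<or> J i = 1" if "i \<in> V" for i using opinion_cases[OF J that] .
  have "up J = 0" using up0 up_nonneg J by (rule E_zeroD)
  moreover have "down J = 0" using \<open>E down = 0\<close> down_nonneg J by (rule E_zeroD)
  ultimately have "arc_sum (\<lambda>i j. (1 - x J i) * (1 - x J j)) = 0" "arc_sum (\<lambda>i j. x J i * x J j) = 0"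
    using arc_sum_up[of J] arc_sum_down[of J] by simp_all
  then have zero: "arc_sum (\<lambda>i j. (1 - x J i) * (1 - x J j) + x J i * x J j) = 0"
    by (simp add: case_prod_unfold sum.distrib)
  let ?f = "\<lambda>e. case e of (i, j) \<Rightarrow> (1 - x J i) * (1 - x J j) + x J i * x J j"
  have nonneg: "0 \<le> ?f e"
    if "e \<in> parcs G" for e
  proof -
    obtain i j where e: "e = (i, j)" by (cases e)
    with that have "i \<in> V" "j \<in> V" using arc_in_V by auto
    then show ?thesis using V[of i] V[of j] by (auto simp: e)
  qed
  have *: "\<forall>e\<in>parcs G. ?f e = 0"
    by (rule iffD1[OF sum_nonneg_eq_0_iff[of "parcs G" ?f] zero]) (simp_all only: finite_parcs nonneg)
  have "parcs G \<subseteq> {i\<in>V. J i = 0} \<times> {i\<in>V. J i = 1} \<union> {i\<in>V. J i = 1} \<times> {i\<in>V. J i = 0}"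
  proof
    fix e assume e: "e \<in> parcs G"
    obtain i j where ij: "e = (i, j)" by (cases e)
    have "i \<in> V" "j \<in> V" using e ij arc_in_V by auto
    with * e ij V[of i] V[of j] show "e \<in> {i\<in>V. J i = 0} \<times> {i\<in>V. J i = 1} \<union> {i\<in>V. J i = 1} \<times> {i\<in>V. J i = 0}"
      by auto
  qed
  then have "bipartite_graph G"
    unfolding bipartite_graph_def using V
    by (intro exI[of _ "{i\<in>V. J i = 0}"] exI[of _ "{i\<in>V. J i = 1}"]) auto
  with not_bipartite show False by simp
qed

text \<open>The random variable \<open>av_S\<close> as a function of the value of \<open>W\<close>.\<close>

definition S :: "int \<Rightarrow> real" where
  "S k = E (\<lambda>J. up J * indicator {J. W J = k} J) / measure_pmf.prob \<pi> {J. W J = k}"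

lemma av_S_eq_at: "av_S G \<pi> J = S (W J)"
proof -
  let ?P = "measure_pmf (anti_voter_pair G \<pi>)"
  have num: "measure ?P {(J0, J1). W J1 = W J0 + 1 \<and> W J0 = W J}
     = E (\<lambda>J0. up J0 * indicator {J0. W J0 = W J} J0)"
  proof -
    have "measure ?P {(J0, J1). W J1 = W J0 + 1 \<and> W J0 = W J}
       = measure_pmf.expectation (anti_voter_pair G \<pi>)
           (indicator {(J0, J1). W J1 = W J0 + 1 \<and> W J0 = W J})"
      by simp
    also have "\<dots> = E (\<lambda>J0. up J0 * indicator {J0. W J0 = W J} J0)"
      unfolding pair_expectation
    proof (rule E_cong)
      fix J0 assume J0: "J0 \<in> set_pmf \<pi>"
      have "(indicator {(J0, J1). W J1 = W J0 + 1 \<and> W J0 = W J} (J0, update J0 i j) :: real)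
          = (1 - x J0 i) * (1 - x J0 j) * indicator {J0. W J0 = W J} J0"
        if "(i, j) \<in> parcs G" for i j
      proof -
        have V: "i \<in> V" "j \<in> V" using that arc_in_V by auto
        show ?thesis
          using opinion_cases[OF J0 V(1)] opinion_cases[OF J0 V(2)]
          by (auto simp: W_update[OF V(1)] indicator_def)
      qed
      then have "arc_sum (\<lambda>i j. indicator {(J0, J1). W J1 = W J0 + 1 \<and> W J0 = W J} (J0, update J0 i j))
         = arc_sum (\<lambda>i j. (1 - x J0 i) * (1 - x J0 j) * indicator {J0. W J0 = W J} J0)"
        by (intro sum.cong) auto
      also have "\<dots> = n * real r * up J0 * indicator {J0. W J0 = W J} J0"
        unfolding arc_sum_up[symmetric] by (simp add: case_prod_unfold sum_distrib_right)
      finally show "arc_sum (\<lambda>i j. indicator {(J0, J1). W J1 = W J0 + 1 \<and> W J0 = W J} (J0, update J0 i j))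
            / (n * real r) = up J0 * indicator {J0. W J0 = W J} J0"
        using n_pos r_pos by simp
    qed
    finally show ?thesis .
  qed
  have "map_pmf fst (anti_voter_pair G \<pi>) = \<pi>"
    by (simp add: anti_voter_pair_def map_bind_pmf map_pmf_comp bind_return_pmf')
  moreover have "fst -` {J0. W J0 = W J} = {(J0 :: 'a \<Rightarrow> int, J1 :: 'a \<Rightarrow> int). W J0 = W J}"
    by auto
  ultimately have den: "measure ?P {(J0, J1). W J0 = W J} = measure_pmf.prob \<pi> {J0. W J0 = W J}"
    using measure_map_pmf[of fst "anti_voter_pair G \<pi>" "{J0. W J0 = W J}"] by simp
  show ?thesis
    unfolding av_S_def S_def cond_prob_def using num den
    by (simp add: case_prod_unfold)
qed

text \<open>\<open>S(W)\<close> is the conditional expectation of \<open>up\<close> given \<open>W\<close>; this is its defining property against functions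
of \<open>W\<close>.\<close>

lemma E_up_eq_E_S: "E (\<lambda>J. up J * g (W J)) = E (\<lambda>J. S (W J) * g (W J))"
proof -
  let ?K = "W ` set_pmf \<pi>"
  have K: "finite ?K" using finite_support by simp
  have expand: "E (\<lambda>J. f J * g (W J)) = (\<Sum>k\<in>?K. E (\<lambda>J. f J * indicator {J. W J = k} J) * g k)"
    for f :: "('a \<Rightarrow> int) \<Rightarrow> real"
  proof -
    have "E (\<lambda>J. f J * g (W J)) = E (\<lambda>J. \<Sum>k\<in>?K. f J * indicator {J. W J = k} J * g k)"
    proof (rule E_cong)
      fix J assume J: "J \<in> set_pmf \<pi>"
      have "(\<Sum>k\<in>?K. f J * indicator {J. W J = k} J * g k)
          = (\<Sum>k\<in>?K. if k = W J then f J * g k else 0)"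
        by (intro sum.cong) (auto simp: indicator_def)
      then show "f J * g (W J) = (\<Sum>k\<in>?K. f J * indicator {J. W J = k} J * g k)"
        using J K by (simp add: sum.delta)
    qed
    also have "\<dots> = (\<Sum>k\<in>?K. E (\<lambda>J. f J * indicator {J. W J = k} J) * g k)"
      by (simp add: E_sum)
    finally show ?thesis .
  qed
  have "E (\<lambda>J. S (W J) * indicator {J. W J = k} J) = E (\<lambda>J. up J * indicator {J. W J = k} J)"
    if "k \<in> ?K" for k
  proof -
    have "measure_pmf.prob \<pi> {J. W J = k} \<noteq> 0"
      using that by (auto simp: measure_pmf_zero_iff)
    moreover have "E (\<lambda>J. S (W J) * indicator {J. W J = k} J) = E (\<lambda>J. S k * indicator {J. W J = k} J)"
      by (rule E_cong) (auto simp: indicator_def)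
    ultimately show ?thesis by (simp add: S_def)
  qed
  then show ?thesis unfolding expand by (intro sum.cong) auto
qed

lemma av_S_eq: "av_S G \<pi> = (\<lambda>J. S (W J))"
  by (rule ext) (rule av_S_eq_at)

lemma var_S_eq: "var_S G \<pi> = measure_pmf.variance (law_W G \<pi>) S"
  unfolding var_S_def law_W_def av_S_eq by simp

text \<open>Conditional expectation is an orthogonal projection, so it decreases the variance.\<close>

lemma var_S_le_variance_up: "var_S G \<pi> \<le> measure_pmf.variance \<pi> up"
proof -
  have mean: "E (\<lambda>J. S (W J)) = E up"
    using E_up_eq_E_S[of "\<lambda>_. 1"] by simp
  \<comment> \<open>Orthogonality of the residual \<open>up - S(W)\<close> to \<open>S(W)\<close>.\<close>
  have cross: "E (\<lambda>J. up J * S (W J)) = E (\<lambda>J. (S (W J))\<^sup>2)"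
    using E_up_eq_E_S[of S] by (simp add: power2_eq_square)
  have "0 \<le> E (\<lambda>J. (up J - S (W J))\<^sup>2)" by simp
  also have "\<dots> = E (\<lambda>J. (up J)\<^sup>2) - E (\<lambda>J. (S (W J))\<^sup>2)"
    by (simp add: power2_diff mult.assoc cross)
  finally show ?thesis
    unfolding var_S_def av_S_eq by (subst (1 2) measure_pmf.variance_eq) (simp_all add: mean)
qed

lemma stein_kernel_W: "stein_kernel (law_W G \<pi>) (mean_W G \<pi>) (var_W G \<pi>) (\<lambda>k. n / 2 * S k)"
proof
  show "finite (set_pmf (law_W G \<pi>))" using finite_support by (simp add: law_W_def)
  show "measure_pmf.variance (law_W G \<pi>) real_of_int = var_W G \<pi>"
    by (simp add: law_W_def var_W_def)
  show "0 < var_W G \<pi>" by (rule var_W_pos)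
  fix g
  show "measure_pmf.expectation (law_W G \<pi>) (\<lambda>w. (real_of_int w - mean_W G \<pi>) * g w)
     = measure_pmf.expectation (law_W G \<pi>) (\<lambda>w. n / 2 * S w * (g (w + 1) - g w))"
    using E_up_eq_E_S[of "\<lambda>w. g (w + 1) - g w"]
    by (simp add: law_W_def mean_W up_kernel mult.assoc)
qed

lemma pmf_law_W_le_q_max: "pmf (law_W G \<pi>) k \<le> q_max G \<pi>"
proof -
  have "measure_pmf.prob \<pi> {J. W J = k} \<le> q_max G \<pi>"
    unfolding q_max_def by (rule cSUP_upper) (auto intro!: bdd_aboveI2[of _ _ 1])
  then show ?thesis by (simp add: law_W_def pmf_map vimage_def)
qed

lemma variance_kernel:
  "measure_pmf.variance (law_W G \<pi>) (\<lambda>k. n / 2 * S k) = (n / 2)\<^sup>2 * var_S G \<pi>"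
  unfolding var_S_eq
  by (simp only: integral_mult_right_zero right_diff_distrib[symmetric] power_mult_distrib)

theorem d_TV_W_le:
  "d_TV (law_W G \<pi>) (TP (mean_W G \<pi>) (var_W G \<pi>))
     \<le> sqrt (var_S G \<pi>) / (2 / n * var_W G \<pi>) + 2 / var_W G \<pi>"
  using stein_kernel.d_TV_TP_le[OF stein_kernel_W]
  unfolding variance_kernel by (simp add: real_sqrt_mult mult.commute)

theorem d_loc_W_le:
  "d_loc (law_W G \<pi>) (TP (mean_W G \<pi>) (var_W G \<pi>))
     \<le> 2 * sqrt (q_max G \<pi> * var_S G \<pi>) / (2 / n * var_W G \<pi>) + 2 / var_W G \<pi>"
proof -
  have "sqrt (q_max G \<pi> * ((n / 2)\<^sup>2 * var_S G \<pi>)) = n / 2 * sqrt (q_max G \<pi> * var_S G \<pi>)"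
    by (simp add: real_sqrt_mult)
  then show ?thesis
    using stein_kernel.d_loc_TP_le[OF stein_kernel_W pmf_law_W_le_q_max]
    unfolding variance_kernel by (simp add: mult.commute)
qed

section \<open>The correlation of W and Q\<close>

definition spin :: "('a \<Rightarrow> int) \<Rightarrow> 'a \<Rightarrow> real" where
  "spin J i = 2 * x J i - 1"

lemma spin_update: "spin (update J i j) k = (if k = i then - spin J j else spin J k)"
  by (simp add: spin_def)

lemma spin_square: "J \<in> set_pmf \<pi> \<Longrightarrow> i \<in> V \<Longrightarrow> spin J i * spin J i = 1"
  using opinion_cases[of J i] by (auto simp: spin_def)

lemma sum_spin: "(\<Sum>i\<in>V. spin J i) = 2 * (real_of_int (W J) - n / 2)"
  by (simp add: spin_def av_W_def sum_subtractf sum_distrib_left)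

lemma Q_eq: "real_of_int (av_Q G J) = arc_sum (\<lambda>i j. spin J i * spin J j)"
  by (simp add: spin_def av_Q_def arc_sum_nested)

lemma up_eq:
  "up J = 1 / 4 - (real_of_int (W J) - n / 2) / n + real_of_int (av_Q G J) / (4 * n * real r)"
proof -
  have "4 * (n * real r * up J) = arc_sum (\<lambda>i j. 1 - spin J i - spin J j + spin J i * spin J j)"
    unfolding arc_sum_up[symmetric] sum_distrib_left
    by (intro sum.cong) (auto simp: spin_def algebra_simps)
  also have "\<dots> = arc_sum (\<lambda>i j. 1) - arc_sum (\<lambda>i j. spin J i) - arc_sum (\<lambda>i j. spin J j)
      + arc_sum (\<lambda>i j. spin J i * spin J j)"
    by (simp only: case_prod_unfold sum_subtractf sum.distrib)
  also have "\<dots> = n * real r - 2 * real r * (2 * (real_of_int (W J) - n / 2)) + real_of_int (av_Q G J)"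
    unfolding arc_sum_const arc_sum_fst arc_sum_snd sum_spin Q_eq by simp
  finally have "up J = (n * real r - 2 * real r * (2 * (real_of_int (W J) - n / 2)) + real_of_int (av_Q G J))
      / (4 * n * real r)"
    by (simp add: eq_divide_eq mult_ac)
  also have "\<dots> = 1 / 4 - (real_of_int (W J) - n / 2) / n + real_of_int (av_Q G J) / (4 * n * real r)"
    by (simp add: add_divide_distrib diff_divide_distrib)
  finally show ?thesis .
qed

text \<open>The eigenvectors of the adjacency matrix for the eigenvalue \<open>-r\<close>. Up to scaling on each component
they are the two-colourings of the bipartite components, continued by zero; speaking of them
avoids walks and components altogether.\<close>

definition alternating :: "('a \<Rightarrow> real) \<Rightarrow> bool" where
  "alternating \<epsilon> \<longleftrightarrow> (\<forall>(i, j)\<in>parcs G. \<epsilon> j = - \<epsilon> i)"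

text \<open>For alternating \<open>\<epsilon>\<close> the sum of \<open>\<epsilon>\<^sub>k s\<^sub>k\<close> over the spins \<open>s\<^sub>k\<close> is a martingale: flipping the spins of one
colour class turns the dynamics into that of the voter model. A stationary martingale has a constant
second moment, so its increments vanish almost surely.\<close>

lemma frozen_arc:
  assumes alt: "alternating \<epsilon>" and J: "J \<in> set_pmf \<pi>" and e: "(i, j) \<in> parcs G" and nz: "\<epsilon> i \<noteq> 0"
  shows "spin J j = - spin J i"
proof -
  define X where "X J = (\<Sum>k\<in>V. \<epsilon> k * spin J k)" for J
  define d where "d J i j = - \<epsilon> i * (spin J i + spin J j)" for J i j
  have Xup: "X (update J i j) = X J + d J i j" if "i \<in> V" for J i j
  proof -
    have "X (update J i j) = (\<Sum>k\<in>V. \<epsilon> k * spin J k + (if k = i then d J i j else 0))"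
      unfolding X_def by (intro sum.cong) (auto simp: spin_update d_def algebra_simps)
    then show ?thesis using that by (simp add: X_def sum.distrib)
  qed
  \<comment> \<open>The martingale property: reversing the arcs cancels the two halves of the drift.\<close>
  have drift: "arc_sum (d J) = 0" for J
  proof -
    have "arc_sum (d J) = arc_sum (\<lambda>i j. - (\<epsilon> i * spin J i) + \<epsilon> j * spin J j)"
      using alt by (intro sum.cong) (auto simp: d_def alternating_def algebra_simps)
    also have "\<dots> = - arc_sum (\<lambda>i j. \<epsilon> i * spin J i) + arc_sum (\<lambda>i j. \<epsilon> j * spin J j)"
      by (simp only: case_prod_unfold sum.distrib sum_negf)
    finally show ?thesis by (simp only: arc_sum_fst arc_sum_snd)
  qed
  have "arc_sum (\<lambda>i j. (X (update J i j))\<^sup>2 - (X J)\<^sup>2) = arc_sum (\<lambda>i j. (d J i j)\<^sup>2)" for J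
  proof -
    have "arc_sum (\<lambda>i j. (X (update J i j))\<^sup>2 - (X J)\<^sup>2) = arc_sum (\<lambda>i j. 2 * X J * d J i j + (d J i j)\<^sup>2)"
      using arc_in_V by (intro sum.cong) (auto simp: Xup power2_sum)
    also have "\<dots> = 2 * X J * arc_sum (d J) + arc_sum (\<lambda>i j. (d J i j)\<^sup>2)"
      by (simp only: case_prod_unfold sum.distrib sum_distrib_left)
    finally show ?thesis by (simp only: drift)
  qed
  then have "E (\<lambda>J. arc_sum (\<lambda>i j. (d J i j)\<^sup>2)) = 0"
    using generator_zero[of "\<lambda>J. (X J)\<^sup>2"] by simp
  then have "arc_sum (\<lambda>i j. (d J i j)\<^sup>2) = 0"
    by (rule E_zeroD[OF _ _ J]) (auto intro!: sum_nonneg)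
  then have "\<forall>e\<in>parcs G. (case e of (i, j) \<Rightarrow> (d J i j)\<^sup>2) = 0"
    by (rule iffD1[OF sum_nonneg_eq_0_iff, rotated 2]) auto
  then have "d J i j = 0" using e by fastforce
  then show ?thesis using nz by (simp add: d_def)
qed

text \<open>The vertices in non-bipartite components.\<close>

definition "unfrozen = {i \<in> V. \<forall>\<epsilon>. alternating \<epsilon> \<longrightarrow> \<epsilon> i = 0}"

lemma unfrozen_subset: "unfrozen \<subseteq> V" by (auto simp: unfrozen_def)

lemma finite_unfrozen [simp]: "finite unfrozen"
  using unfrozen_subset finite_V by (rule finite_subset)

lemma unfrozen_arc: "(i, j) \<in> parcs G \<Longrightarrow> i \<in> unfrozen \<longleftrightarrow> j \<in> unfrozen"
proof -
  assume e: "(i, j) \<in> parcs G"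
  have "\<epsilon> i = 0 \<longleftrightarrow> \<epsilon> j = 0" if "alternating \<epsilon>" for \<epsilon>
    using that e by (auto simp: alternating_def)
  then show ?thesis using arc_in_V[OF e] by (auto simp: unfrozen_def)
qed

lemma frozen_antiparallel:
  assumes "J \<in> set_pmf \<pi>" "(i, j) \<in> parcs G" "i \<notin> unfrozen"
  shows "spin J j = - spin J i"
proof -
  obtain \<epsilon> where "alternating \<epsilon>" "\<epsilon> i \<noteq> 0"
    using assms arc_in_V by (auto simp: unfrozen_def)
  then show ?thesis using assms frozen_arc by blast
qed

text \<open>Sum the relation \<open>s\<^sub>j = - s\<^sub>i\<close> over the arcs between frozen vertices: by regularity both sides are
multiples of the same total, which therefore equals its own negative.\<close>

lemma sum_spin_unfrozen:
  assumes J: "J \<in> set_pmf \<pi>"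
  shows "(\<Sum>i\<in>V. spin J i) = (\<Sum>i\<in>unfrozen. spin J i)"
proof -
  define f where "f i = (if i \<in> unfrozen then 0 else spin J i)" for i
  have "arc_sum (\<lambda>i j. f i) = arc_sum (\<lambda>i j. - f j)"
    using frozen_antiparallel[OF J] unfrozen_arc by (intro sum.cong) (auto simp: f_def)
  then have "real r * (\<Sum>i\<in>V. f i) = - (real r * (\<Sum>i\<in>V. f i))"
    unfolding arc_sum_fst arc_sum_snd by (simp add: sum_negf)
  then have "(\<Sum>i\<in>V. f i) = 0" by simp
  moreover have "(\<Sum>i\<in>V. f i) = (\<Sum>i\<in>V - unfrozen. spin J i)"
    by (intro sum.mono_neutral_cong_right) (auto simp: f_def)
  ultimately show ?thesis
    using sum.subset_diff[OF unfrozen_subset finite_V, of "spin J"] by simp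
qed

text \<open>If \<open>\<phi>\<close> changes sign without losing modulus along each arc that starts at a point of maximal modulus,
then \<open>\<phi>\<close> restricted to these points is alternating, and alternating functions vanish at unfrozen
vertices.\<close>

lemma maximum_principle:
  assumes neigh: "\<And>i j. (i, j) \<in> parcs G \<Longrightarrow> i \<in> unfrozen \<Longrightarrow> \<bar>\<phi> i\<bar> = M \<Longrightarrow> \<phi> j = - \<phi> i"
    and "i \<in> unfrozen" "\<bar>\<phi> i\<bar> = (M :: real)"
  shows "M = 0"
proof (rule ccontr)
  assume M: "M \<noteq> 0"
  define \<epsilon> where "\<epsilon> i = (if i \<in> unfrozen \<and> \<bar>\<phi> i\<bar> = M then \<phi> i else 0)" for i
  have "alternating \<epsilon>"
    unfolding alternating_def
  proof clarify
    fix i j assume e: "(i, j) \<in> parcs G"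
    show "\<epsilon> j = - \<epsilon> i"
    proof (cases "i \<in> unfrozen \<and> \<bar>\<phi> i\<bar> = M")
      case True
      then have "\<phi> j = - \<phi> i" "j \<in> unfrozen" using neigh[OF e] unfrozen_arc[OF e] by simp_all
      with True show ?thesis by (simp add: \<epsilon>_def)
    next
      case False
      have "\<not> (j \<in> unfrozen \<and> \<bar>\<phi> j\<bar> = M)"
      proof
        assume "j \<in> unfrozen \<and> \<bar>\<phi> j\<bar> = M"
        then have "\<phi> i = - \<phi> j" "i \<in> unfrozen" "\<bar>\<phi> j\<bar> = M"
          using neigh[OF arc_sym[OF e]] unfrozen_arc[OF e] by simp_all
        with False show False by simp
      qed
      with False show ?thesis by (simp only: \<epsilon>_def if_False minus_zero)
    qed
  qed
  moreover have "\<epsilon> i \<noteq> 0" using assms(2,3) M by (auto simp: \<epsilon>_def)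
  ultimately show False using assms(2) by (auto simp: unfrozen_def)
qed

lemma moment1_recursion:
  assumes "a \<in> V"
  shows "(\<Sum>j\<in>N a. E (\<lambda>J. spin J j) + E (\<lambda>J. spin J a)) = 0"
proof -
  have "arc_sum (\<lambda>i j. spin (update J i j) a - spin J a) = - (\<Sum>j\<in>N a. spin J j + spin J a)" for J
  proof -
    have "arc_sum (\<lambda>i j. spin (update J i j) a - spin J a)
       = (\<Sum>i\<in>V. if i = a then (\<Sum>j\<in>N a. - spin J j - spin J a) else 0)"
      unfolding arc_sum_nested spin_update by (intro sum.cong) auto
    then show ?thesis using assms by (simp add: sum_negf[symmetric])
  qed
  then have "E (\<lambda>J. - (\<Sum>j\<in>N a. spin J j + spin J a)) = 0"
    using generator_zero[of "\<lambda>J. spin J a"] by (simp only:)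
  then have "E (\<lambda>J. \<Sum>j\<in>N a. spin J j + spin J a) = 0"
    by (simp only: Bochner_Integration.integral_minus neg_equal_0_iff_equal)
  then show ?thesis
    by (simp only: E_sum Bochner_Integration.integral_add integrable_support)
qed

text \<open>Only an update at \<open>a\<close>, \<open>b\<close> or \<open>c\<close> changes the product, and it replaces one factor by minus a neighbouring
spin. The three vertices have to be distinct for the factors to be updated separately.\<close>

lemma moment3_recursion:
  assumes V: "a \<in> V" "b \<in> V" "c \<in> V" and distinct: "a \<noteq> b" "a \<noteq> c" "b \<noteq> c"
  defines "f \<equiv> \<lambda>i j k. E (\<lambda>J. spin J i * spin J j * spin J k)"
  shows "(\<Sum>j\<in>N a. f j b c + f a b c) + (\<Sum>j\<in>N b. f a j c + f a b c) + (\<Sum>j\<in>N c. f a b j + f a b c) = 0"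
proof -
  let ?h = "\<lambda>J. spin J a * spin J b * spin J c"
  let ?A = "\<lambda>J. \<Sum>j\<in>N a. spin J j * spin J b * spin J c + ?h J"
  let ?B = "\<lambda>J. \<Sum>j\<in>N b. spin J a * spin J j * spin J c + ?h J"
  let ?C = "\<lambda>J. \<Sum>j\<in>N c. spin J a * spin J b * spin J j + ?h J"
  have "arc_sum (\<lambda>i j. ?h (update J i j) - ?h J) = - (?A J + ?B J + ?C J)" for J
  proof -
    have "arc_sum (\<lambda>i j. ?h (update J i j) - ?h J)
       = (\<Sum>i\<in>V. (if i = a then - ?A J else 0) + (if i = b then - ?B J else 0) + (if i = c then - ?C J else 0))"
      unfolding arc_sum_nested spin_update using distinct
      by (intro sum.cong refl) (auto simp: sum_negf[symmetric] simp del: of_int_diff intro!: sum.cong)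
    then show ?thesis using V by (simp add: sum.distrib)
  qed
  then have "E (\<lambda>J. - (?A J + ?B J + ?C J)) = 0"
    using generator_zero[of ?h] by (simp only:)
  then have "E (\<lambda>J. ?A J + ?B J + ?C J) = 0"
    by (simp only: Bochner_Integration.integral_minus neg_equal_0_iff_equal)
  then show ?thesis
    unfolding f_def by (simp only: E_sum Bochner_Integration.integral_add integrable_support)
qed

lemma moment1_zero:
  assumes "i \<in> unfrozen"
  shows "E (\<lambda>J. spin J i) = 0"
proof -
  define f where "f i = E (\<lambda>J. spin J i)" for i
  define M where "M = Max ((\<lambda>i. \<bar>f i\<bar>) ` unfrozen)"
  have le: "\<bar>f i\<bar> \<le> M" if "i \<in> unfrozen" for i
    unfolding M_def using that by (intro Max_ge) auto
  have "M \<in> (\<lambda>i. \<bar>f i\<bar>) ` unfrozen"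
    unfolding M_def using assms by (intro Max_in) auto
  then obtain a where a: "a \<in> unfrozen" "\<bar>f a\<bar> = M" by auto
  have "M = 0"
  proof (rule maximum_principle[where \<phi> = f, OF _ a])
    fix i j assume e: "(i, j) \<in> parcs G" and i: "i \<in> unfrozen" "\<bar>f i\<bar> = M"
    have iV: "i \<in> V" using i unfrozen_subset by auto
    have Ni: "\<bar>f j\<bar> \<le> M" if "j \<in> N i" for j
      using that i unfrozen_arc[of i j] le by (auto simp: neighbours_def)
    have "(\<Sum>j\<in>N i. sgn (f i) * (f j + f i)) = 0"
      using moment1_recursion[OF iV] unfolding f_def[symmetric] sum_distrib_left[symmetric] by simp
    moreover have "0 \<le> sgn (f i) * (f j + f i)" if "j \<in> N i" for j
      using Ni[OF that] i(2) by (auto simp: sgn_if)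
    ultimately have "\<forall>j\<in>N i. sgn (f i) * (f j + f i) = 0"
      by (subst (asm) sum_nonneg_eq_0_iff) auto
    then have "sgn (f i) * (f j + f i) = 0" using e by (auto simp: neighbours_def)
    then show "f j = - f i"
      using Ni[of j] e i(2) by (auto simp: neighbours_def sgn_if split: if_splits)
  qed
  then show ?thesis using le[OF assms] by (simp add: f_def)
qed

text \<open>Moments with a repeated vertex reduce to first moments, because spins square to one, and so vanish on
unfrozen vertices. If the largest modulus were positive, it would be attained only at
distinct vertices, where the recursion makes the moment an average of its neighbours with the opposite
sign. The maximum principle, applied in the first vertex alone, excludes that.\<close>

lemma moment3_zero:
  assumes "i \<in> unfrozen" "j \<in> unfrozen" "k \<in> unfrozen"
  shows "E (\<lambda>J. spin J i * spin J j * spin J k) = 0"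
proof -
  define f where "f i j k = E (\<lambda>J. spin J i * spin J j * spin J k)" for i j k
  define K where "K = (\<lambda>(i, j, k). \<bar>f i j k\<bar>) ` (unfrozen \<times> unfrozen \<times> unfrozen)"
  define M where "M = Max K"
  have finK: "finite K" by (simp add: K_def)
  have le: "\<bar>f i j k\<bar> \<le> M" if "i \<in> unfrozen" "j \<in> unfrozen" "k \<in> unfrozen" for i j k
    unfolding M_def using that finK by (intro Max_ge) (auto simp: K_def intro!: image_eqI[of _ _ "(i, j, k)"])
  have "M \<in> K" unfolding M_def using assms finK by (intro Max_in) (auto simp: K_def)
  then obtain a b c where abc: "a \<in> unfrozen" "b \<in> unfrozen" "c \<in> unfrozen" "\<bar>f a b c\<bar> = M"
    by (auto simp: K_def)
  have coalesce1: "f i i k = 0" if "i \<in> unfrozen" "k \<in> unfrozen" for i k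
  proof -
    have "f i i k = E (\<lambda>J. spin J k)"
      unfolding f_def using spin_square that unfrozen_subset by (intro E_cong) auto
    then show ?thesis using moment1_zero that by simp
  qed
  have coalesce2: "f i j i = 0" if "i \<in> unfrozen" "j \<in> unfrozen" for i j
  proof -
    have "f i j i = f i i j" unfolding f_def by (simp add: mult_ac)
    then show ?thesis using coalesce1 that by simp
  qed
  have coalesce3: "f i j j = 0" if "i \<in> unfrozen" "j \<in> unfrozen" for i j
  proof -
    have "f i j j = f j j i" unfolding f_def by (simp add: mult_ac)
    then show ?thesis using coalesce1 that by simp
  qed
  have "M = 0"
  proof (rule maximum_principle[OF _ abc(1), of "\<lambda>i. f i b c"])
    fix i j assume e: "(i, j) \<in> parcs G" and i: "i \<in> unfrozen" "\<bar>f i b c\<bar> = M"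
    have jU: "j \<in> unfrozen" using unfrozen_arc[OF e] i by simp
    show "f j b c = - f i b c"
    proof (cases "M = 0")
      case True
      then show ?thesis using i le[OF jU abc(2,3)] by simp
    next
      case False
      then have d: "i \<noteq> b" "i \<noteq> c" "b \<noteq> c"
        using i abc coalesce1 coalesce2 coalesce3 by auto
      let ?s = "sgn (f i b c)"
      have NU: "l \<in> unfrozen" if "k \<in> unfrozen" "l \<in> N k" for k l
        using that unfrozen_arc[of k l] by (auto simp: neighbours_def)
      \<comment> \<open>At a maximum of the modulus all terms of the recursion have the same sign, so each one vanishes.\<close>
      have nn: "0 \<le> ?s * (f k l m + f i b c)" if "k \<in> unfrozen" "l \<in> unfrozen" "m \<in> unfrozen" for k l m
        using le[OF that] i(2) by (auto simp: sgn_if)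
      have "(\<Sum>j\<in>N i. f j b c + f i b c) + (\<Sum>j\<in>N b. f i j c + f i b c) + (\<Sum>j\<in>N c. f i b j + f i b c) = 0"
        unfolding f_def using i abc d unfrozen_subset by (intro moment3_recursion) auto
      then have "?s * ((\<Sum>j\<in>N i. f j b c + f i b c) + (\<Sum>j\<in>N b. f i j c + f i b c)
          + (\<Sum>j\<in>N c. f i b j + f i b c)) = 0"
        by (simp only: mult_zero_right)
      then have "(\<Sum>j\<in>N i. ?s * (f j b c + f i b c)) + (\<Sum>j\<in>N b. ?s * (f i j c + f i b c))
          + (\<Sum>j\<in>N c. ?s * (f i b j + f i b c)) = 0"
        by (simp only: distrib_left sum_distrib_left)
      moreover have "0 \<le> (\<Sum>j\<in>N i. ?s * (f j b c + f i b c))" "0 \<le> (\<Sum>j\<in>N b. ?s * (f i j c + f i b c))"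
          "0 \<le> (\<Sum>j\<in>N c. ?s * (f i b j + f i b c))"
        using i abc NU by (auto intro!: sum_nonneg nn)
      ultimately have "(\<Sum>j\<in>N i. ?s * (f j b c + f i b c)) = 0" by linarith
      then have "\<forall>j\<in>N i. ?s * (f j b c + f i b c) = 0"
        by (rule iffD1[OF sum_nonneg_eq_0_iff, rotated 2]) (use i abc NU in \<open>auto intro!: nn\<close>)
      then have "?s * (f j b c + f i b c) = 0" using e by (auto simp: neighbours_def)
      then show ?thesis using False i(2) by (auto simp: sgn_if split: if_splits)
    qed
  qed (rule abc(4))
  then show ?thesis using le[OF assms] by (simp add: f_def)
qed

text \<open>The covariance expands into third moments \<open>E (s\<^sub>i s\<^sub>j s\<^sub>k)\<close> with \<open>i\<close> unfrozen and \<open>(j, k)\<close> an arc. An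
arc does not leave the set of unfrozen vertices: either all three vertices are unfrozen, or \<open>s\<^sub>j s\<^sub>k = -1\<close>
almost surely and only a first moment remains.\<close>

lemma W_Q_uncorrelated:
  "E (\<lambda>J. (real_of_int (W J) - n / 2) * real_of_int (av_Q G J)) = 0"
proof -
  have "2 * E (\<lambda>J. (real_of_int (W J) - n / 2) * real_of_int (av_Q G J))
      = E (\<lambda>J. (2 * (real_of_int (W J) - n / 2)) * real_of_int (av_Q G J))"
    by (simp only: mult.assoc integral_mult_right_zero)
  also have "\<dots> = E (\<lambda>J. (\<Sum>i\<in>unfrozen. spin J i) * arc_sum (\<lambda>j k. spin J j * spin J k))"
    unfolding Q_eq sum_spin[symmetric] by (intro E_cong) (simp only: sum_spin_unfrozen)
  also have "\<dots> = (\<Sum>i\<in>unfrozen. \<Sum>(j, k)\<in>parcs G. E (\<lambda>J. spin J i * (spin J j * spin J k)))"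
    unfolding sum_product by (simp only: case_prod_unfold E_sum)
  also have "\<dots> = 0"
  proof (intro sum.neutral ballI, clarify)
    fix i j k assume i: "i \<in> unfrozen" and e: "(j, k) \<in> parcs G"
    show "E (\<lambda>J. spin J i * (spin J j * spin J k)) = 0"
    proof (cases "j \<in> unfrozen")
      case True
      then show ?thesis
        using moment3_zero[OF i, of j k] unfrozen_arc[OF e] by (simp only: mult.assoc)
    next
      case False
      have "E (\<lambda>J. spin J i * (spin J j * spin J k)) = E (\<lambda>J. - spin J i)"
      proof (rule E_cong)
        fix J assume J: "J \<in> set_pmf \<pi>"
        have "spin J j * spin J k = - (spin J j * spin J j)"
          unfolding frozen_antiparallel[OF J e False] by (rule mult_minus_right)
        also have "spin J j * spin J j = 1"
          using spin_square[OF J] arc_in_V(1)[OF e] by simp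
        finally show "spin J i * (spin J j * spin J k) = - spin J i" by simp
      qed
      also have "\<dots> = 0"
        by (simp only: Bochner_Integration.integral_minus moment1_zero[OF i] minus_zero)
      finally show ?thesis .
    qed
  qed
  finally show ?thesis by simp
qed

theorem var_S_le:
  "var_S G \<pi> \<le> (16 * (real r)\<^sup>2 * var_W G \<pi> + var_Q G \<pi>) / (16 * (real r)\<^sup>2 * n\<^sup>2)"
proof -
  define Q where "Q = (\<lambda>J. real_of_int (av_Q G J))"
  define X where "X J = real_of_int (W J) - n / 2" for J
  define q where "q = E Q"
  define \<alpha> where "\<alpha> = 1 / n"
  define \<beta> where "\<beta> = 1 / (4 * n * real r)"
  have m: "E (\<lambda>J. real_of_int (W J)) = n / 2" using mean_W by (simp add: mean_W_def)
  have EX: "E X = 0" unfolding X_def by (simp add: m)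
  have varW: "var_W G \<pi> = E (\<lambda>J. (X J)\<^sup>2)" by (simp only: var_W_def m X_def)
  have varQ: "var_Q G \<pi> = E (\<lambda>J. (Q J - q)\<^sup>2)" by (simp add: var_Q_def Q_def q_def)
  have cross: "E (\<lambda>J. X J * (Q J - q)) = 0"
  proof -
    have "E (\<lambda>J. X J * (Q J - q)) = E (\<lambda>J. X J * Q J) - E X * q"
      by (simp add: right_diff_distrib)
    then show ?thesis using W_Q_uncorrelated EX by (simp add: X_def Q_def)
  qed
  have up: "up J = 1 / 4 - \<alpha> * X J + \<beta> * Q J" for J
    by (simp add: up_eq X_def Q_def \<alpha>_def \<beta>_def)
  have "E up = 1 / 4 - \<alpha> * E X + \<beta> * q"
    unfolding up q_def by simp
  then have dev: "up J - E up = \<beta> * (Q J - q) - \<alpha> * X J" for J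
    unfolding up[of J] EX by (simp add: algebra_simps)
  have "measure_pmf.variance \<pi> up
     = E (\<lambda>J. \<beta>\<^sup>2 * (Q J - q)\<^sup>2 - 2 * \<alpha> * \<beta> * (X J * (Q J - q)) + \<alpha>\<^sup>2 * (X J)\<^sup>2)"
    unfolding dev by (intro E_cong) (simp add: power2_eq_square algebra_simps)
  also have "\<dots> = \<beta>\<^sup>2 * var_Q G \<pi> + \<alpha>\<^sup>2 * var_W G \<pi>"
    by (simp only: Bochner_Integration.integral_add Bochner_Integration.integral_diff
        integrable_support integral_mult_right_zero cross varQ varW mult_zero_right diff_0_right)
  also have "\<dots> = (16 * (real r)\<^sup>2 * var_W G \<pi> + var_Q G \<pi>) / (16 * (real r)\<^sup>2 * n\<^sup>2)"
    unfolding \<alpha>_def \<beta>_def using n_pos r_pos by (simp add: field_simps power2_eq_square)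
  finally show ?thesis using var_S_le_variance_up by simp
qed

section \<open>Rates of convergence\<close>

lemma var_Q_nonneg: "0 \<le> var_Q G \<pi>"
  by (simp add: var_Q_def)

context
  fixes \<sigma> v :: real
  defines "\<sigma> \<equiv> sqrt (var_W G \<pi>)"
    and "v \<equiv> sqrt (var_Q G \<pi>) / (real r * \<sigma>\<^sup>2)"
begin

lemma sigma_pos: "0 < \<sigma>" and sigma_square: "\<sigma>\<^sup>2 = var_W G \<pi>"
  using var_W_pos by (simp_all add: \<sigma>_def)

lemma v_nonneg: "0 \<le> v"
  by (simp add: v_def var_Q_nonneg)

lemma sqrt_var_S_le: "sqrt (var_S G \<pi>) / (2 / n * \<sigma>\<^sup>2) \<le> v + 1 / \<sigma>"
proof -
  have "var_S G \<pi> \<le> (\<sigma> / n)\<^sup>2 + (sqrt (var_Q G \<pi>) / (4 * real r * n))\<^sup>2"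
    using var_S_le n_pos
    by (simp add: sigma_square power_divide power_mult_distrib var_Q_nonneg add_divide_distrib)
  then have "sqrt (var_S G \<pi>) \<le> sqrt ((\<sigma> / n)\<^sup>2 + (sqrt (var_Q G \<pi>) / (4 * real r * n))\<^sup>2)"
    by simp
  also have "\<dots> \<le> \<sigma> / n + sqrt (var_Q G \<pi>) / (4 * real r * n)"
    using sigma_pos n_pos var_Q_nonneg by (intro sqrt_sum_squares_le_sum) auto
  finally have "sqrt (var_S G \<pi>) / (2 / n * \<sigma>\<^sup>2)
      \<le> (\<sigma> / n + sqrt (var_Q G \<pi>) / (4 * real r * n)) / (2 / n * \<sigma>\<^sup>2)"
    using sigma_pos n_pos by (intro divide_right_mono) auto
  also have "\<dots> = 1 / 2 * (1 / \<sigma>) + 1 / 8 * v"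
    unfolding v_def using sigma_pos n_pos by (simp add: field_simps power2_eq_square)
  also have "\<dots> \<le> v + 1 / \<sigma>"
  proof -
    have "0 \<le> 1 / \<sigma>" using sigma_pos by simp
    then show ?thesis using v_nonneg by linarith
  qed
  finally show ?thesis .
qed

lemma d_TV_W_rate:
  assumes "1 \<le> \<sigma>"
  shows "d_TV (law_W G \<pi>) (TP (mean_W G \<pi>) (\<sigma>\<^sup>2)) \<le> 3 * (v + 1 / \<sigma>)"
proof -
  have tail: "2 / \<sigma>\<^sup>2 \<le> 2 * (1 / \<sigma>)"
    using assms by (simp add: field_simps power2_eq_square)
  note d_TV_W_le[folded sigma_square]
  also have "sqrt (var_S G \<pi>) / (2 / n * \<sigma>\<^sup>2) + 2 / \<sigma>\<^sup>2 \<le> (v + 1 / \<sigma>) + 2 * (1 / \<sigma>)"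
    by (intro add_mono sqrt_var_S_le tail)
  also have "\<dots> \<le> 3 * (v + 1 / \<sigma>)" using v_nonneg by simp
  finally show ?thesis .
qed

text \<open>The local bound contains \<open>q\<^sub>m\<^sub>a\<^sub>x\<close>, which the total variation bound itself controls: \<open>W\<close> cannot have an
atom much larger than those of the approximating law.\<close>

lemma q_max_rate:
  assumes "1 \<le> \<sigma>"
  shows "q_max G \<pi> \<le> 6 * (v + 1 / \<sigma>)"
  unfolding q_max_def
proof (rule cSUP_least)
  fix k
  have "measure_pmf.prob \<pi> {J. av_W G J = k} = pmf (law_W G \<pi>) k"
    by (simp add: law_W_def pmf_map vimage_def)
  also have "\<dots> \<le> d_TV (law_W G \<pi>) (TP (mean_W G \<pi>) (\<sigma>\<^sup>2)) + pmf (TP (mean_W G \<pi>) (\<sigma>\<^sup>2)) k"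
    by (rule pmf_le_d_TV)
  also have "\<dots> \<le> 3 * (v + 1 / \<sigma>) + exp 1 / sqrt (\<sigma>\<^sup>2)"
    using sigma_pos by (intro add_mono d_TV_W_rate assms pmf_TP_le) simp
  also have "exp 1 / sqrt (\<sigma>\<^sup>2) \<le> 3 / \<sigma>"
    using sigma_pos exp_le by (simp add: divide_right_mono)
  finally show "measure_pmf.prob \<pi> {J. av_W G J = k} \<le> 6 * (v + 1 / \<sigma>)"
    using v_nonneg by simp
qed simp

lemma d_loc_W_rate:
  assumes "1 \<le> \<sigma>"
  shows "d_loc (law_W G \<pi>) (TP (mean_W G \<pi>) (\<sigma>\<^sup>2)) \<le> 20 * (v powr (3/2) + 1 / \<sigma> powr (3/2))"
proof -
  define y where "y = v + 1 / \<sigma>"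
  have y: "0 < y" using v_nonneg sigma_pos by (simp add: y_def add_nonneg_pos)
  have "sqrt (q_max G \<pi>) \<le> sqrt (9 * y)"
    using q_max_rate[OF assms] y unfolding y_def by simp
  also have "\<dots> = 3 * y powr (1/2)"
    using y by (simp add: real_sqrt_mult powr_half_sqrt)
  finally have q: "sqrt (q_max G \<pi>) \<le> 3 * y powr (1/2)" .
  have "2 * sqrt (q_max G \<pi> * var_S G \<pi>) / (2 / n * \<sigma>\<^sup>2)
      = 2 * (sqrt (q_max G \<pi>) * (sqrt (var_S G \<pi>) / (2 / n * \<sigma>\<^sup>2)))"
    by (simp add: real_sqrt_mult)
  also have "\<dots> \<le> 2 * (3 * y powr (1/2) * y)"
    using q sqrt_var_S_le y sigma_pos n_pos unfolding y_def[symmetric]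
    by (intro mult_left_mono mult_mono) (auto simp: var_S_def)
  also have "\<dots> = 6 * y powr (3/2)"
    using y powr_add[of y "1/2" 1] by simp
  also have "\<dots> \<le> 6 * (3 * (v powr (3/2) + (1 / \<sigma>) powr (3/2)))"
    unfolding y_def using v_nonneg sigma_pos by (intro mult_left_mono powr_three_halves_add_le) auto
  also have "(1 / \<sigma>) powr (3/2) = 1 / \<sigma> powr (3/2)"
    using sigma_pos by (simp add: powr_divide)
  finally have main: "2 * sqrt (q_max G \<pi> * var_S G \<pi>) / (2 / n * \<sigma>\<^sup>2)
      \<le> 18 * (v powr (3/2) + 1 / \<sigma> powr (3/2))" by simp
  have "\<sigma> powr (3/2) \<le> \<sigma> powr 2" using assms by (intro powr_mono) auto
  then have tail: "2 / \<sigma>\<^sup>2 \<le> 2 * (1 / \<sigma> powr (3/2))"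
    using sigma_pos by (simp add: frac_le)
  note d_loc_W_le[folded sigma_square]
  also have "2 * sqrt (q_max G \<pi> * var_S G \<pi>) / (2 / n * \<sigma>\<^sup>2) + 2 / \<sigma>\<^sup>2
      \<le> 18 * (v powr (3/2) + 1 / \<sigma> powr (3/2)) + 2 * (1 / \<sigma> powr (3/2))"
    by (intro add_mono main tail)
  also have "\<dots> \<le> 20 * (v powr (3/2) + 1 / \<sigma> powr (3/2))" by simp
  finally show ?thesis .
qed

lemma v_powr: "v powr (3/2) = var_Q G \<pi> powr (3/4) / (real r powr (3/2) * \<sigma> ^ 3)"
proof -
  have "v powr (3/2) = sqrt (var_Q G \<pi>) powr (3/2) / (real r * \<sigma>\<^sup>2) powr (3/2)"
    unfolding v_def using var_Q_nonneg sigma_pos by (intro powr_divide)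
  also have "sqrt (var_Q G \<pi>) powr (3/2) = var_Q G \<pi> powr (3/4)"
    using var_Q_nonneg by (simp add: powr_half_sqrt[symmetric] powr_powr)
  also have "(real r * \<sigma>\<^sup>2) powr (3/2) = real r powr (3/2) * (\<sigma>\<^sup>2) powr (3/2)"
    using sigma_pos by (intro powr_mult)
  also have "(\<sigma>\<^sup>2) powr (3/2) = (\<sigma> powr 2) powr (3/2)"
    using sigma_pos by simp
  also have "\<dots> = \<sigma> ^ 3"
    unfolding powr_powr using sigma_pos powr_realpow[of \<sigma> 3] by simp
  finally show ?thesis .
qed

end

end

theorem theorem4p5:
  shows
    "(\<forall>(G :: 'a pair_pre_digraph) (r :: nat) (n :: nat) (\<pi> :: ('a \<Rightarrow> int) pmf) (\<mu> :: real)
       (\<sigma> :: real) (lam :: real).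
        pair_graph G \<longrightarrow> card (pverts G) = n \<longrightarrow> regular_graph G r \<longrightarrow>
        \<not> bipartite_graph G \<longrightarrow> \<not> cycle_graph G n \<longrightarrow>
        anti_voter_equilibrium G \<pi> \<longrightarrow>
        \<mu> = mean_W G \<pi> \<longrightarrow> \<sigma> = sqrt (var_W G \<pi>) \<longrightarrow> lam = 2 / real n \<longrightarrow>
          d_TV (law_W G \<pi>) (TP \<mu> (\<sigma>\<^sup>2))
            \<le> sqrt (var_S G \<pi>) / (lam * \<sigma>\<^sup>2) + 2 / \<sigma>\<^sup>2 \<and>
          d_loc (law_W G \<pi>) (TP \<mu> (\<sigma>\<^sup>2))
            \<le> 2 * sqrt (q_max G \<pi> * var_S G \<pi>) / (lam * \<sigma>\<^sup>2) + 2 / \<sigma>\<^sup>2 \<and>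
          var_S G \<pi> \<le> (16 * (real r)\<^sup>2 * \<sigma>\<^sup>2 + var_Q G \<pi>) / (16 * (real r)\<^sup>2 * (real n)\<^sup>2))
     \<and>
     (\<forall>(G :: nat \<Rightarrow> 'a pair_pre_digraph) (r :: nat \<Rightarrow> nat) (n :: nat \<Rightarrow> nat)
       (\<pi> :: nat \<Rightarrow> ('a \<Rightarrow> int) pmf) (\<mu> :: nat \<Rightarrow> real) (\<sigma> :: nat \<Rightarrow> real).
        (\<forall>k. pair_graph (G k) \<and> card (pverts (G k)) = n k \<and> regular_graph (G k) (r k) \<and>
             \<not> bipartite_graph (G k) \<and> \<not> cycle_graph (G k) (n k) \<and>
             anti_voter_equilibrium (G k) (\<pi> k) \<and>
             \<mu> k = mean_W (G k) (\<pi> k) \<and> \<sigma> k = sqrt (var_W (G k) (\<pi> k))) \<longrightarrow>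
        filterlim n at_top sequentially \<longrightarrow>
        filterlim (\<lambda>k. (\<sigma> k)\<^sup>2) at_top sequentially \<longrightarrow>
          (\<lambda>k. d_TV (law_W (G k) (\<pi> k)) (TP (\<mu> k) ((\<sigma> k)\<^sup>2)))
            \<in> O(\<lambda>k. sqrt (var_Q (G k) (\<pi> k)) / (real (r k) * (\<sigma> k)\<^sup>2) + 1 / \<sigma> k) \<and>
          (\<lambda>k. d_loc (law_W (G k) (\<pi> k)) (TP (\<mu> k) ((\<sigma> k)\<^sup>2)))
            \<in> O(\<lambda>k. var_Q (G k) (\<pi> k) powr (3/4) / (real (r k) powr (3/2) * \<sigma> k ^ 3)
                    + 1 / \<sigma> k powr (3/2)))"
    (is "?bounds \<and> ?rates")
proof
  show ?bounds
  proof (intro allI impI)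
    fix G :: "'a pair_pre_digraph" and r n :: nat and \<pi> :: "('a \<Rightarrow> int) pmf" and \<mu> \<sigma> lam :: real
    assume "pair_graph G" and n: "card (pverts G) = n" and "regular_graph G r"
      and "\<not> bipartite_graph G" and "anti_voter_equilibrium G \<pi>"
      and \<mu>: "\<mu> = mean_W G \<pi>" and \<sigma>: "\<sigma> = sqrt (var_W G \<pi>)" and lam: "lam = 2 / real n"
    then interpret anti_voter G r \<pi>
      by (intro anti_voter.intro anti_voter_axioms.intro)
    have "\<sigma>\<^sup>2 = var_W G \<pi>" using var_W_pos by (simp add: \<sigma>)
    then show "d_TV (law_W G \<pi>) (TP \<mu> (\<sigma>\<^sup>2)) \<le> sqrt (var_S G \<pi>) / (lam * \<sigma>\<^sup>2) + 2 / \<sigma>\<^sup>2 \<and>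
          d_loc (law_W G \<pi>) (TP \<mu> (\<sigma>\<^sup>2))
            \<le> 2 * sqrt (q_max G \<pi> * var_S G \<pi>) / (lam * \<sigma>\<^sup>2) + 2 / \<sigma>\<^sup>2 \<and>
          var_S G \<pi> \<le> (16 * (real r)\<^sup>2 * \<sigma>\<^sup>2 + var_Q G \<pi>) / (16 * (real r)\<^sup>2 * (real n)\<^sup>2)"
      using d_TV_W_le d_loc_W_le var_S_le by (simp only: \<mu> lam n)
  qed
  show ?rates
  proof (intro allI impI)
    fix G :: "nat \<Rightarrow> 'a pair_pre_digraph" and r n :: "nat \<Rightarrow> nat"
      and \<pi> :: "nat \<Rightarrow> ('a \<Rightarrow> int) pmf" and \<mu> \<sigma> :: "nat \<Rightarrow> real"
    assume H: "\<forall>k. pair_graph (G k) \<and> card (pverts (G k)) = n k \<and> regular_graph (G k) (r k) \<and>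
             \<not> bipartite_graph (G k) \<and> \<not> cycle_graph (G k) (n k) \<and>
             anti_voter_equilibrium (G k) (\<pi> k) \<and>
             \<mu> k = mean_W (G k) (\<pi> k) \<and> \<sigma> k = sqrt (var_W (G k) (\<pi> k))"
      and lim: "filterlim (\<lambda>k. (\<sigma> k)\<^sup>2) at_top sequentially"
    have av: "anti_voter (G k) (r k) (\<pi> k)" for k
      using H by (intro anti_voter.intro anti_voter_axioms.intro) auto
    have \<mu>: "\<mu> k = mean_W (G k) (\<pi> k)" and \<sigma>: "\<sigma> k = sqrt (var_W (G k) (\<pi> k))" for k
      using H by auto
    have "eventually (\<lambda>k. 1 \<le> (\<sigma> k)\<^sup>2) sequentially"
      using lim by (simp add: filterlim_at_top)
    then have large: "eventually (\<lambda>k. 1 \<le> \<sigma> k) sequentially"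
    proof eventually_elim
      case (elim k)
      have "0 < \<sigma> k" unfolding \<sigma> by (rule anti_voter.sigma_pos[OF av])
      then show ?case using elim by (simp add: power2_nonneg_ge_1_iff)
    qed
    show "(\<lambda>k. d_TV (law_W (G k) (\<pi> k)) (TP (\<mu> k) ((\<sigma> k)\<^sup>2)))
            \<in> O(\<lambda>k. sqrt (var_Q (G k) (\<pi> k)) / (real (r k) * (\<sigma> k)\<^sup>2) + 1 / \<sigma> k) \<and>
          (\<lambda>k. d_loc (law_W (G k) (\<pi> k)) (TP (\<mu> k) ((\<sigma> k)\<^sup>2)))
            \<in> O(\<lambda>k. var_Q (G k) (\<pi> k) powr (3/4) / (real (r k) powr (3/2) * \<sigma> k ^ 3)
                    + 1 / \<sigma> k powr (3/2))"
    proof (intro conjI bigoI)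
      show "eventually (\<lambda>k. norm (d_TV (law_W (G k) (\<pi> k)) (TP (\<mu> k) ((\<sigma> k)\<^sup>2)))
          \<le> 3 * norm (sqrt (var_Q (G k) (\<pi> k)) / (real (r k) * (\<sigma> k)\<^sup>2) + 1 / \<sigma> k)) sequentially"
        using large
      proof eventually_elim
        case (elim k)
        from anti_voter.d_TV_W_rate[OF av[of k]] elim d_TV_nonneg show ?case
          unfolding \<mu> \<sigma> real_norm_def by (smt (verit, best))
      qed
      show "eventually (\<lambda>k. norm (d_loc (law_W (G k) (\<pi> k)) (TP (\<mu> k) ((\<sigma> k)\<^sup>2)))
          \<le> 20 * norm (var_Q (G k) (\<pi> k) powr (3/4) / (real (r k) powr (3/2) * \<sigma> k ^ 3)
                    + 1 / \<sigma> k powr (3/2))) sequentially"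
        using large
      proof eventually_elim
        case (elim k)
        from anti_voter.d_loc_W_rate[OF av[of k]] elim d_loc_nonneg show ?case
          unfolding \<mu> \<sigma> real_norm_def anti_voter.v_powr[OF av[of k]] by (smt (verit, best))
      qed
    qed
  qed
qed

end
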